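(* Let $m,n\in\mathbb{Z}$ with $m\le -1$ and $n\le -1$, and let $\mu,\nu$ be the (nonnegative) integers determined by the parity cases below. Then: - if $m=-2\mu$, $n=-2\nu$: $\mathfrak{S}(q_{m,n}) = (z_+\,p_+\,p_-\,z_-)^{\nu}\,(z_+\,z_-)^{\mu-1}\,z_+\,\hat{z}_-\,z_+\,(z_-\,z_+)^{\mu-1}\,(z_-\,p_-\,p_+\,z_+)^{\nu}$; - if $m=-2\mu$, $n=-2\nu-1$: $\mathfrak{S}(q_{m,n}) = (z_+\,p_+\,p_-\,z_-)^{\nu}\,z_+\,(p_+\,p_-)^{\mu}\,\hat{p}_+\,(p_-\,p_+)^{\mu}\,z_+\,(z_-\,p_-\,p_+\,z_+)^{\nu}$; - if $m=-2\mu-1$, $n=-2\nu$: $\mathfrak{S}(q_{m,n}) = (z_+\,p_+\,p_-\,z_-)^{\nu}\,(z_+\,z_-)^{\mu}\,\hat{z}_+\,(z_-\,z_+)^{\mu}\,(z_-\,p_-\,p_+\,z_+)^{\nu}$; - if $m=-2\mu-1$, $n=-2\nu-1$: $\mathfrak{S}(q_{m,n}) = (z_+\,p_+\,p_-\,z_-)^{\nu}\,z_+\,(p_+\,p_-)^{\mu}\,p_+\,\hat{p}_-\,p_+\,(p_-\,p_+)^{\mu}\,z_+\,(z_-\,p_-\,p_+\,z_+)^{\nu}$.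
   Context: For real parameters $a=(a_0,a_1,a_2)$ with $a_0+a_1+a_2=1$, $a_1\neq 0$, the fourth Painlevé equation $P_{IV}$ is $q''=\frac{(q')^2}{2q}+\frac32 q^3+4tq^2+2(t^2+a_2-a_0)q-\frac{2a_1^2}{q}$. Poles of a solution are simple with residue $\pm1$: residue $+1$ is a plus pole ($p_+$), residue $-1$ a minus pole ($p_-$). Zeros are simple with $q(t)=2\epsilon a_1(t-t_* )+O((t-t_* )^2)$, $\epsilon\in\{\pm1\}$: $\epsilon=+1$ a plus zero ($z_+$), $\epsilon=-1$ a minus zero ($z_-$). The generalised Okamoto polynomials $Q_{m,n}(t)$ are defined by $Q_{m,n-1}Q_{m,n+1}=\frac92(Q_{m,n}''Q_{m,n}-(Q_{m,n}')^2)+(2t^2+3(m+2n+1))Q_{m,n}^2$, $Q_{m+1,n}Q_{m-1,n}=\frac92(Q_{m,n}''Q_{m,n}-(Q_{m,n}')^2)+(2t^2+3(-2m+n-1))Q_{m,n}^2$, with $Q_{0,0}=Q_{-1,0}=Q_{0,-1}=1$, $Q_{-1,-1}=\sqrt2\,t$. The generalised Okamoto rational $q_{m,n}=-\frac23 t+\frac{d}{dt}\log\frac{Q_{m-1,n}}{Q_{m,n}}$ solves $P_{IV}$ with $a=(\frac13-m-n,\frac13+n,\frac13+m)$. For a real solution $q$ with real zeros/poles $t_1<\dots<t_N$, the singularity signature $\mathfrak{S}(q)$ is the word $s_1\cdots s_N$, $s_i\in\{z_+,z_-,p_+,p_-\}$ the type at $t_i$; $(w)^k$ is $k$-fold repetition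 ($(w)^0$ empty), and $\hat s$ marks the letter at $t=0$.
   Formalization: The second recurrence for Q_{m,n} is used with constant 3(-2m-n-1) instead of 3(-2m+n-1); with the printed sign Q_{-2,-1}=4t^4-9 and Q_{-3,-1} is not a polynomial, so the Q_{m,n} would not exist. *)

theory Defs
  imports "HOL-Analysis.Analysis" "HOL-Computational_Algebra.Polynomial" "HOL-Library.Landau_Symbols"
begin

definition okamoto_family :: "(int \<Rightarrow> int \<Rightarrow> real poly) \<Rightarrow> bool" where
  "okamoto_family Q \<longleftrightarrow>
     Q 0 0 = 1 \<and> Q (-1) 0 = 1 \<and> Q 0 (-1) = 1 \<and> Q (-1) (-1) = [:0, sqrt 2:] \<and>
     (\<forall>m n. m \<le> 0 \<longrightarrow> n \<le> -1 \<longrightarrow>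
        Q m (n - 1) * Q m (n + 1) =
          smult (9/2) (pderiv (pderiv (Q m n)) * Q m n - (pderiv (Q m n))\<^sup>2)
          + [:of_int (3 * (m + 2 * n + 1)), 0, 2:] * (Q m n)\<^sup>2) \<and>
     (\<forall>m n. m \<le> -1 \<longrightarrow> n \<le> 0 \<longrightarrow>
        Q (m + 1) n * Q (m - 1) n =
          smult (9/2) (pderiv (pderiv (Q m n)) * Q m n - (pderiv (Q m n))\<^sup>2)
          + [:of_int (3 * (- 2 * m - n - 1)), 0, 2:] * (Q m n)\<^sup>2)"

text \<open>The generalised Okamoto rational solution
  q m n = -2t/3 + d/dt log (Q (m-1) n / Q m n), written as a difference of logarithmic derivatives.\<close>

definition okamoto_rational :: "(int \<Rightarrow> int \<Rightarrow> real poly) \<Rightarrow> int \<Rightarrow> int \<Rightarrow> real \<Rightarrow> real" where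
  "okamoto_rational Q m n t =
     - (2/3) * t + poly (pderiv (Q (m - 1) n)) t / poly (Q (m - 1) n) t
                 - poly (pderiv (Q m n)) t / poly (Q m n) t"

datatype sing = Zp | Zm | Pp | Pm

definition is_real_zero :: "(real \<Rightarrow> real) \<Rightarrow> real \<Rightarrow> bool" where
  "is_real_zero q t \<longleftrightarrow> isCont q t \<and> q t = 0"

definition is_real_pole :: "(real \<Rightarrow> real) \<Rightarrow> real \<Rightarrow> bool" where
  "is_real_pole q t \<longleftrightarrow> filterlim (\<lambda>s. \<bar>q s\<bar>) at_top (at t)"

text \<open>Type of a singularity for P_IV with parameter a1:
  plus/minus pole: simple pole with residue +1/-1, i.e. q s = r/(s-t) + O(1);
  plus/minus zero: q s = 2 eps a1 (s - t) + O((s-t)^2) with q t = 0.\<close>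

fun has_sing_type :: "real \<Rightarrow> (real \<Rightarrow> real) \<Rightarrow> sing \<Rightarrow> real \<Rightarrow> bool" where
  "has_sing_type a1 q Zp t \<longleftrightarrow> q t = 0 \<and>
      (\<lambda>s. q s - 2 * a1 * (s - t)) \<in> O[at t](\<lambda>s. (s - t)\<^sup>2)"
| "has_sing_type a1 q Zm t \<longleftrightarrow> q t = 0 \<and>
      (\<lambda>s. q s + 2 * a1 * (s - t)) \<in> O[at t](\<lambda>s. (s - t)\<^sup>2)"
| "has_sing_type a1 q Pp t \<longleftrightarrow> (\<lambda>s. q s - 1 / (s - t)) \<in> O[at t](\<lambda>_. 1)"
| "has_sing_type a1 q Pm t \<longleftrightarrow> (\<lambda>s. q s + 1 / (s - t)) \<in> O[at t](\<lambda>_. 1)"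

text \<open>The singularity signature of q is  pre @ [c] @ post, with the marked letter c
  located at t = 0: the real zeros and poles of q, listed increasingly as ts, have
  types given letter by letter, and ts ! (length pre) = 0.\<close>

definition has_signature ::
  "real \<Rightarrow> (real \<Rightarrow> real) \<Rightarrow> sing list \<Rightarrow> sing \<Rightarrow> sing list \<Rightarrow> bool" where
  "has_signature a1 q pre c post \<longleftrightarrow>
     (\<exists>ts :: real list.
        sorted_wrt (<) ts \<and>
        set ts = {t. is_real_zero q t \<or> is_real_pole q t} \<and>
        length ts = length (pre @ [c] @ post) \<and>
        (\<forall>i < length ts. has_sing_type a1 q ((pre @ [c] @ post) ! i) (ts ! i)) \<and>
        ts ! length pre = 0)"

definition wpow :: "sing list \<Rightarrow> nat \<Rightarrow> sing list" where
  "wpow w k = concat (replicate k w)"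

end

(* The points (m, n) carry the triangular lattice with steps (1,0), (0,-1), (-1,1) and their negatives.
   On a triangle with vertices A, B, C the functions f_A = -2t/3 + B'/B - C'/C (and cyclically) solve
   the symmetric form of P_IV; q_(m,n) is such a function for a horizontal edge. Reflecting the vertex A
   in the edge BC to a vertex N gives f_A = const * A N / (B C), so zeros and poles of f_A are the roots of
   the four polynomials of a rhombus. The slope of f_A at every root of A has one sign, at every root
   of N the other, and its residues at the roots of B and C are 1 and -1. Hence the sign of f_A changes at
   every letter, and the signature alternates between falling letters (N, C) and rising ones (A, B), with
   f_A positive at minus infinity and negative at plus infinity. An alternating word is determined by what
   remains after deleting the letters of N, i.e. by the order of the roots on the triangle A, B, C, so
   the signatures propagate over the lattice from the triangle of constant polynomials. *)

theory Submission
  imports Defs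
begin

section \<open>Triangles and reflections\<close>

text \<open>With T for 2t/3, \<open>tri\<close> and \<open>toda\<close> together say f_A f_B = c0^2
  M N / C^2, while \<open>edge\<close> says f_B = c0 M B / (C A). Dividing leaves f_A = c0 A N / (B
  C); the proof is this division with denominators cleared.\<close>

lemma toda_to_edge_ring:
  fixes A :: "'a::idom"
  assumes tri: "C2*A*B - C1*(A1*B + A*B1) + C*A1*B1 + T*C*(B1*A - A1*B) + k*C*A*B = 0"
    and edge: "C1*A - C*A1 - T*C*A = c0*(M*B)"
    and toda: "c0*c0*(M*N) = C2*C - C1*C1 + (T*T + k)*(C*C)"
    and nz: "c0 \<noteq> 0" "M \<noteq> 0" "B \<noteq> 0"
  shows "B1*C - B*C1 - T*B*C = c0*(A*N)"
proof -
  have "(c0*(M*B)) * (B1*C - B*C1 - T*B*C) - A*B*(c0*c0*(M*N)) =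
     - C * (C2*A*B - C1*(A1*B + A*B1) + C*A1*B1 + T*C*(B1*A - A1*B) + k*C*A*B)"
    unfolding edge[symmetric] toda by (simp add: algebra_simps)
  then have "(c0*(M*B)) * (B1*C - B*C1 - T*B*C) = (c0*(M*B)) * (c0*(A*N))"
    unfolding tri by (simp add: algebra_simps)
  with nz show ?thesis by simp
qed

text \<open>The same division at the other end of the edge: f_C f_A = c0^2 M N / B^2 and f_C = c0 M
  C / (A B).\<close>

lemma toda_to_edge_ring':
  fixes A :: "'a::idom"
  assumes tri: "B2*C*A - B1*(C1*A + C*A1) + B*C1*A1 + T*B*(A1*C - C1*A) + k*B*C*A = 0"
    and edge: "A1*B - A*B1 - T*A*B = c0*(M*C)"
    and toda: "c0*c0*(M*N) = B2*B - B1*B1 + (T*T + k)*(B*B)"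
    and nz: "c0 \<noteq> 0" "M \<noteq> 0" "C \<noteq> 0"
  shows "B1*C - B*C1 - T*B*C = c0*(A*N)"
proof -
  have "(c0*(M*C)) * (B1*C - B*C1 - T*B*C) - A*C*(c0*c0*(M*N)) =
     - B * (B2*C*A - B1*(C1*A + C*A1) + B*C1*A1 + T*B*(A1*C - C1*A) + k*B*C*A)"
    unfolding edge[symmetric] toda by (simp add: algebra_simps)
  then have "(c0*(M*C)) * (B1*C - B*C1 - T*B*C) = (c0*(M*C)) * (c0*(A*N))"
    unfolding tri by (simp add: algebra_simps)
  with nz show ?thesis by simp
qed

text \<open>The difference of the relations at B and C is the symmetric P_IV equation f_A' = f_A
  (f_C - f_B) - (b - c + T1). Inserting f_A = c0 A N / (B C) leaves f_A (A'/A - N'/N) = b - c +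
  T1.\<close>

lemma wronskian_ring:
  fixes A :: "'a::idom"
  assumes triB: "B2*C*A - B1*(C1*A + C*A1) + B*C1*A1 + T*B*(A1*C - C1*A) + b*B*C*A = 0"
    and triC: "C2*A*B - C1*(A1*B + A*B1) + C*A1*B1 + T*C*(B1*A - A1*B) + c*C*A*B = 0"
    and edge: "B1*C - B*C1 - T*B*C = c0*(A*N)"
    and edge': "B2*C - B*C2 - T1*B*C - T*(B1*C + B*C1) = c0*(A1*N + A*N1)"
    and nz: "A \<noteq> 0"
  shows "c0 * (A1*N - A*N1) = (b - c + T1)*B*C"
proof -
  have "A * (c0 * (A1*N - A*N1)) = 2*A1*(c0*(A*N)) - A*(c0*(A1*N + A*N1))"
    by (simp add: algebra_simps)
  also have "\<dots> = A * ((b - c + T1)*B*C)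
      - (B2*C*A - B1*(C1*A + C*A1) + B*C1*A1 + T*B*(A1*C - C1*A) + b*B*C*A)
      + (C2*A*B - C1*(A1*B + A*B1) + C*A1*B1 + T*C*(B1*A - A1*B) + c*C*A*B)"
    unfolding edge[symmetric] edge'[symmetric] by (simp add: algebra_simps)
  finally have "A * (c0 * (A1*N - A*N1)) = A * ((b - c + T1)*B*C)"
    unfolding triB triC by simp
  with nz show ?thesis by simp
qed

text \<open>The relation at A is a linear second-order equation in A. The Wronskian of A and N has
  the form given by Abel's formula, so N is a second solution with the same a. At B and C, replacing
  A by N keeps f_A and changes f_C by - K / f_A and f_B by K / f_A; the products f_C f_A and f_A f_B
  change by - K and K, which b and c absorb.\<close>

lemma reflect_ring:
  fixes A :: "'a::idom"
  assumes triA: "A2*B*C - A1*(B1*C + B*C1) + A*B1*C1 + T*A*(C1*B - B1*C) + a*A*B*C = 0"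
    and triB: "B2*C*A - B1*(C1*A + C*A1) + B*C1*A1 + T*B*(A1*C - C1*A) + b*B*C*A = 0"
    and triC: "C2*A*B - C1*(A1*B + A*B1) + C*A1*B1 + T*C*(B1*A - A1*B) + c*C*A*B = 0"
    and edge: "B1*C - B*C1 - T*B*C = c0*(A*N)"
    and wr: "c0 * (A1*N - A*N1) = K*B*C"
    and wr': "c0 * (A2*N - A*N2) = K*(B1*C + B*C1)"
    and nz: "A \<noteq> 0" "c0 \<noteq> 0"
  shows "N2*B*C - N1*(B1*C + B*C1) + N*B1*C1 + T*N*(C1*B - B1*C) + a*N*B*C = 0" (is "?NA = 0")
    and "B2*C*N - B1*(C1*N + C*N1) + B*C1*N1 + T*B*(N1*C - C1*N) + (b-K)*B*C*N = 0" (is "?NB = 0")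
    and "C2*N*B - C1*(N1*B + N*B1) + C*N1*B1 + T*C*(B1*N - N1*B) + (c+K)*C*N*B = 0" (is "?NC = 0")
proof -
  have "c0*A*?NA = c0*N*(A2*B*C - A1*(B1*C + B*C1) + A*B1*C1 + T*A*(C1*B - B1*C) + a*A*B*C)
      - B*C*(c0 * (A2*N - A*N2)) + (B1*C + B*C1)*(c0 * (A1*N - A*N1))"
    by (simp add: algebra_simps)
  also have "\<dots> = 0" unfolding triA wr wr' by (simp add: algebra_simps)
  finally show "?NA = 0" using nz by simp
  have "c0*A*?NB = c0*N*(B2*C*A - B1*(C1*A + C*A1) + B*C1*A1 + T*B*(A1*C - C1*A) + b*B*C*A)
      + (c0 * (A1*N - A*N1))*(B1*C - B*C1 - T*B*C) - K*B*C*(c0*(A*N))"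
    by (simp add: algebra_simps)
  also have "\<dots> = 0" unfolding triB wr edge by (simp add: algebra_simps)
  finally show "?NB = 0" using nz by simp
  have "c0*A*?NC = c0*N*(C2*A*B - C1*(A1*B + A*B1) + C*A1*B1 + T*C*(B1*A - A1*B) + c*C*A*B)
      - (c0 * (A1*N - A*N1))*(B1*C - B*C1 - T*B*C) + K*B*C*(c0*(A*N))"
    by (simp add: algebra_simps)
  also have "\<dots> = 0" unfolding triC wr edge by (simp add: algebra_simps)
  finally show "?NC = 0" using nz by simp
qed

text \<open>P_IV in terms of logarithmic derivatives is the difference of two of the relations
  (log A)'' = f_B f_C - 4t^2/9 - k; after clearing denominators the double poles cancel.\<close>

definition trilinear :: "real poly \<Rightarrow> real poly \<Rightarrow> real poly \<Rightarrow> real \<Rightarrow> bool" where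
  "trilinear A B C k \<longleftrightarrow>
     pderiv (pderiv A) * B * C - pderiv A * (pderiv B * C + B * pderiv C) + A * pderiv B * pderiv C
     + [:0, 2/3:] * A * (pderiv C * B - pderiv B * C) + [:k:] * A * B * C = 0"

text \<open>The edge B C of a triangle A B C, with N the reflection of A: f_A = - (sqrt 2 / 3) A N / (B C).\<close>

definition edge :: "real poly \<Rightarrow> real poly \<Rightarrow> real poly \<Rightarrow> real poly \<Rightarrow> bool" where
  "edge A N B C \<longleftrightarrow>
     pderiv B * C - B * pderiv C - [:0, 2/3:] * B * C = [:- (sqrt 2 / 3):] * (A * N)"

text \<open>The shape of the Okamoto recurrences. Divided by (9/2) p^2, the right side is (log p)''
  + 4t^2/9 + k, so \<open>k\<close> is 2/9 of the constant in the recurrence and matches the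
  constant of \<open>trilinear\<close>.\<close>

definition toda :: "real poly \<Rightarrow> real poly \<Rightarrow> real poly \<Rightarrow> real \<Rightarrow> bool" where
  "toda M N p k \<longleftrightarrow> M * N = smult (9/2) (pderiv (pderiv p) * p - (pderiv p)\<^sup>2)
     + [:(9/2) * k, 0, 2:] * p\<^sup>2"

text \<open>The square of the edge constant is 2/9, which cancels the factor 9/2.\<close>

lemma toda_scaled:
  assumes "toda M N p k"
  shows "[:- (sqrt 2 / 3):] * [:- (sqrt 2 / 3):] * (M * N)
    = pderiv (pderiv p) * p - pderiv p * pderiv p + ([:0, 2/3:] * [:0, 2/3:] + [:k:]) * (p * p)"
proof -
  have c: "[:- (sqrt 2 / 3):] * [:- (sqrt 2 / 3):] = [:2/9:]" by simp
  have "[:0, 2/3:] * [:0, 2/3:] + [:k:] = smult (2/9) [:(9/2) * k, 0, 2:]" by simp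
  then show ?thesis using assms unfolding toda_def c
    by (simp add: smult_add_right power2_eq_square mult.commute)
qed

lemma edge_of_toda:
  assumes "trilinear C A B c" "edge M B C A" "toda M N C c" "M \<noteq> 0" "B \<noteq> 0"
  shows "edge A N B C"
  using toda_to_edge_ring[OF assms(1)[unfolded trilinear_def] assms(2)[unfolded edge_def] toda_scaled[OF assms(3)]] assms(4,5)
  unfolding edge_def by simp

lemma edge_of_toda':
  assumes "trilinear B C A b" "edge M C A B" "toda M N B b" "M \<noteq> 0" "C \<noteq> 0"
  shows "edge A N B C"
  using toda_to_edge_ring'[OF assms(1)[unfolded trilinear_def] assms(2)[unfolded edge_def] toda_scaled[OF assms(3)]] assms(4,5)
  unfolding edge_def by simp

text \<open>Simplicity and coprimality are only needed at real zeros.\<close>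

definition real_roots_simple :: "real poly \<Rightarrow> bool" where
  "real_roots_simple p \<longleftrightarrow> (\<forall>x. poly p x = 0 \<longrightarrow> poly (pderiv p) x \<noteq> 0)"

definition no_common_root :: "real poly \<Rightarrow> real poly \<Rightarrow> bool" where
  "no_common_root p r \<longleftrightarrow> (\<forall>x. poly p x = 0 \<longrightarrow> poly r x \<noteq> 0)"

definition triangle :: "real poly \<Rightarrow> real poly \<Rightarrow> real poly \<Rightarrow> real \<Rightarrow> real \<Rightarrow> real \<Rightarrow> bool" where
  "triangle A B C a b c \<longleftrightarrow>
     trilinear A B C a \<and> trilinear B C A b \<and> trilinear C A B c \<and>
     A \<noteq> 0 \<and> B \<noteq> 0 \<and> C \<noteq> 0 \<and>
     real_roots_simple A \<and> real_roots_simple B \<and> real_roots_simple C \<and>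
     no_common_root A B \<and> no_common_root B C \<and> no_common_root C A"

lemma triangle_rotate: "triangle A B C a b c \<Longrightarrow> triangle B C A b c a"
  by (auto simp: triangle_def)

lemma wronskian:
  assumes "trilinear B C A b" "trilinear C A B c" "edge A N B C" "A \<noteq> 0"
  shows "[:- (sqrt 2 / 3):] * (pderiv A * N - A * pderiv N) = [:b - c + 2/3:] * B * C"
proof -
  have "pderiv (pderiv B * C - B * pderiv C - [:0, 2/3:] * B * C) = pderiv ([:- (sqrt 2 / 3):] * (A * N))"
    using assms(3) by (simp add: edge_def)
  then have "pderiv (pderiv B) * C - B * pderiv (pderiv C) - [:2/3:] * B * C
      - [:0, 2/3:] * (pderiv B * C + B * pderiv C) = [:- (sqrt 2 / 3):] * (pderiv A * N + A * pderiv N)"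
    unfolding pderiv_diff pderiv_mult by (simp add: pderiv_pCons algebra_simps smult_add_right pderiv_smult pderiv_minus)
  from wronskian_ring[OF assms(1,2)[unfolded trilinear_def] assms(3)[unfolded edge_def] this assms(4)]
  show ?thesis by (simp add: algebra_simps)
qed

lemma wronskian_poly:
  assumes "triangle A B C a b c" "edge A N B C"
  shows "- (sqrt 2 / 3) * (poly (pderiv A) x * poly N x - poly A x * poly (pderiv N) x)
    = (b - c + 2/3) * poly B x * poly C x"
  using arg_cong[OF wronskian[of B C A b c N], of "\<lambda>p. poly p x"] assms
  by (simp add: triangle_def algebra_simps)

lemma edge_poly:
  assumes "edge A N B C"
  shows "poly (pderiv B) x * poly C x - poly B x * poly (pderiv C) x - (2/3) * x * poly B x * poly C x
    = - (sqrt 2 / 3) * (poly A x * poly N x)"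
  using arg_cong[OF assms[unfolded edge_def], of "\<lambda>p. poly p x"] by (simp add: algebra_simps)

text \<open>With K = b - c + 2/3 the new constants are b - K = c - 2/3 and c + K = b + 2/3. The
  Wronskian relation with K positive is what carries simplicity and coprimality over to N.\<close>

lemma
  assumes tr: "triangle A B C a b c" and ed: "edge A N B C" and k: "b - c + 2/3 > 0"
  shows triangle_reflect: "triangle N B C a (c - 2/3) (b + 2/3)"
    and reflect_coprime: "no_common_root A N"
proof -
  let ?K = "b - c + 2/3"
  have trA: "trilinear A B C a" and trB: "trilinear B C A b" and trC: "trilinear C A B c"
    and nz: "A \<noteq> 0" "B \<noteq> 0" "C \<noteq> 0" using tr by (auto simp: triangle_def)
  note wr = wronskian[OF trB trC ed nz(1)]
  have "pderiv ([:- (sqrt 2 / 3):] * (pderiv A * N - A * pderiv N)) = pderiv ([:?K:] * B * C)"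
    using wr by simp
  then have "[:- (sqrt 2 / 3):] * (pderiv (pderiv A) * N - A * pderiv (pderiv N))
     = [:?K:] * (pderiv B * C + B * pderiv C)"
    unfolding pderiv_diff pderiv_mult by (simp add: pderiv_pCons algebra_simps smult_add_right pderiv_smult pderiv_minus pderiv_diff pderiv_mult)
  note tri = reflect_ring[OF trA[unfolded trilinear_def] trB[unfolded trilinear_def] trC[unfolded trilinear_def]
      ed[unfolded edge_def] wr this nz(1)]
  have N: "trilinear N B C a" "trilinear B C N (c - 2/3)" "trilinear C N B (b + 2/3)"
    using tri unfolding trilinear_def by simp_all
  have Nnz: "N \<noteq> 0" using wr k nz by auto
  have ep: "poly (pderiv B) x * poly C x - poly B x * poly (pderiv C) x - (2/3) * x * poly B x * poly C x
    = - (sqrt 2 / 3) * (poly A x * poly N x)" for x by (rule edge_poly[OF ed])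
  have wp: "- (sqrt 2 / 3) * (poly (pderiv A) x * poly N x - poly A x * poly (pderiv N) x)
    = ?K * poly B x * poly C x" for x by (rule wronskian_poly[OF tr ed])
  \<comment> \<open>At a common root of N and B the edge relation leaves B' C = 0, at one of N and C
    it leaves B C' = 0; both contradict simple, disjoint roots.\<close>
  have BC: "poly B x \<noteq> 0 \<and> poly C x \<noteq> 0" if "poly N x = 0" for x
    using ep[of x] that tr by (auto simp: triangle_def real_roots_simple_def no_common_root_def)
  \<comment> \<open>At a root of N the Wronskian relation equates a multiple of A N' with K B C,
    which is nonzero.\<close>
  have s: "poly A x \<noteq> 0 \<and> poly (pderiv N) x \<noteq> 0" if "poly N x = 0" for x
    using wp[of x] that BC[OF that] k by auto
  show "triangle N B C a (c - 2/3) (b + 2/3)"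
    using tr N Nnz BC s by (auto simp: triangle_def real_roots_simple_def no_common_root_def)
  show "no_common_root A N" using s by (auto simp: no_common_root_def)
qed

section \<open>Alternating words\<close>

text \<open>A letter is falling if the function changes sign from plus to minus there (for a negative parameter).\<close>

fun falling :: "sing \<Rightarrow> bool" where
  "falling Zp = True" | "falling Zm = False" | "falling Pp = False" | "falling Pm = True"

text \<open>The flag says whether the function is currently positive; it must end up negative.\<close>

fun alternating :: "bool \<Rightarrow> sing list \<Rightarrow> bool" where
  "alternating b [] = (\<not> b)"
| "alternating b (c # w) = (falling c = b \<and> alternating (\<not> b) w)"

lemma alternating_append:
  "alternating b v \<Longrightarrow> alternating b (v @ w) = alternating False w"
  by (induction b v rule: alternating.induct) auto

text \<open>\<open>Zp\<close> is falling, so the letter after it rises and cannot be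
  \<open>Zp\<close>. If just one word starts with \<open>Zp\<close>, the other starts with a falling
  letter, which would have to be the rising second letter of the first word. The end condition of
  \<open>alternating\<close> rules out a surplus final \<open>Zp\<close>.\<close>

lemma alternating_unique:
  assumes "alternating b v" "alternating b w" "filter (\<lambda>c. c \<noteq> Zp) v = filter (\<lambda>c. c \<noteq> Zp) w"
  shows "v = w"
  using assms
proof (induction b v arbitrary: w rule: alternating.induct)
  case (1 b)
  show ?case
  proof (cases w)
    case (Cons d u)
    with 1 have "d = Zp" "b = False" by (simp_all split: if_splits)
    with 1 Cons show ?thesis by simp
  qed simp
next
  case (2 b c v)
  note IH = this
  have rising: "d \<noteq> Zp" if "alternating False (d # u)" for d u using that by (cases d) simp_all
  show ?case
  proof (cases w)
    case Nil
    with IH(4) have "c = Zp" by (simp split: if_splits)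
    with Nil IH(2,3) show ?thesis by simp
  next
    case (Cons d u)
    consider "c = d" | "c = Zp" "d \<noteq> Zp" | "c \<noteq> Zp" "d = Zp" | "c \<noteq> d" "c \<noteq> Zp" "d \<noteq> Zp" by blast
    then show ?thesis
    proof cases
      case 1
      with IH(2-4) Cons have "alternating (\<not> b) v" "alternating (\<not> b) u"
        "filter (\<lambda>c. c \<noteq> Zp) v = filter (\<lambda>c. c \<noteq> Zp) u" by (simp_all split: if_splits)
      from IH(1)[OF this] 1 Cons show ?thesis by simp
    next
      case 2
      with IH(2,3) Cons have b: "b" "falling d" "alternating False v" by auto
      have "filter (\<lambda>c. c \<noteq> Zp) v = d # filter (\<lambda>c. c \<noteq> Zp) u" using IH(4) Cons 2 by simp
      moreover from this obtain e y where y: "v = e # y" by (cases v) auto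
      moreover have "e \<noteq> Zp" using rising b(3) y by blast
      ultimately have "e = d" by simp
      with b y show ?thesis by simp
    next
      case 3
      with IH(2,3) Cons have b: "b" "falling c" "alternating False u" by auto
      have "filter (\<lambda>c. c \<noteq> Zp) u = c # filter (\<lambda>c. c \<noteq> Zp) v" using IH(4) Cons 3 by simp
      moreover from this obtain e y where y: "u = e # y" by (cases u) auto
      moreover have "e \<noteq> Zp" using rising b(3) y by blast
      ultimately have "e = c" by simp
      with b y show ?thesis by simp
    next
      case 4
      with IH(4) Cons show ?thesis by simp
    qed
  qed
qed

section \<open>Sign changes at simple roots\<close>

text \<open>Every root to the right of \<open>a\<close> is a crossing, and its direction is forced
  by the sign of \<open>p\<close> before it. Falling letters sit where \<open>p\<close> increases
  because \<open>p\<close> will have the sign opposite to f_A.\<close>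

lemma root_derivative_alternating:
  fixes p :: "real poly"
  assumes "\<And>x. poly p x = 0 \<Longrightarrow> poly (pderiv p) x \<noteq> 0"
    and lab: "\<And>x. poly p x = 0 \<Longrightarrow> falling (lab x) \<longleftrightarrow> poly (pderiv p) x > 0"
    and top: "\<And>x. x \<ge> K \<Longrightarrow> poly p x > 0"
    and "sorted_wrt (<) xs" "set xs = {x. a < x \<and> poly p x = 0}" "poly p a \<noteq> 0"
  shows "alternating (poly p a < 0) (map lab xs)"
  using assms(4-6)
proof (induction xs arbitrary: a)
  case Nil
  have "poly p a > 0"
  proof (rule ccontr)
    assume "\<not> poly p a > 0"
    with Nil(3) have n: "poly p a < 0" by linarith
    moreover have "poly p (max K (a + 1)) > 0" using top by simp
    moreover have "a < max K (a + 1)" by simp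
    ultimately obtain x where "x > a" "poly p x = 0"
      using poly_IVT_pos[of a "max K (a+1)" p] by blast
    with Nil show False by auto
  qed
  then show ?case by simp
next
  case (Cons x xs)
  have x: "a < x" "poly p x = 0" using Cons.prems(2) by auto
  have nor: "poly p y \<noteq> 0" if "a < y" "y < x" for y
    using that Cons.prems(1,2) by (force simp: set_eq_iff)
  have d: "(poly p has_real_derivative poly (pderiv p) x) (at x)" by (rule poly_DERIV)
  have dnz: "poly (pderiv p) x \<noteq> 0" using assms(1) x by simp
  \<comment> \<open>A crossing in the wrong direction would give \<open>p\<close> opposite signs at
    \<open>a\<close> and just left of \<open>x\<close>, hence a root before
    \<open>x\<close>.\<close>
  have sgn: "poly p a < 0 \<longleftrightarrow> poly (pderiv p) x > 0"
  proof -
    have False if pa: "poly p a < 0" and px: "poly (pderiv p) x < 0"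
    proof -
      obtain e where e: "e > 0" "\<And>h. 0 < h \<Longrightarrow> h < e \<Longrightarrow> poly p x < poly p (x - h)"
        using DERIV_neg_dec_left[OF d px] by auto
      define y where "y = x - min (e/2) ((x - a)/2)"
      have y: "a < y" "y < x" "poly p y > 0" using e x unfolding y_def by (auto simp: min_def field_simps)
      then obtain z where "a < z" "z < y" "poly p z = 0" using poly_IVT_pos[of a y p] pa by auto
      with nor y show False by auto
    qed
    moreover have False if pa: "poly p a > 0" and px: "poly (pderiv p) x > 0"
    proof -
      obtain e where e: "e > 0" "\<And>h. 0 < h \<Longrightarrow> h < e \<Longrightarrow> poly p (x - h) < poly p x"
        using DERIV_pos_inc_left[OF d px] by auto
      define y where "y = x - min (e/2) ((x - a)/2)"
      have y: "a < y" "y < x" "poly p y < 0" using e x unfolding y_def by (auto simp: min_def field_simps)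
      then obtain z where "a < z" "z < y" "poly p z = 0" using poly_IVT_neg[of a y p] pa by auto
      with nor y show False by auto
    qed
    ultimately show ?thesis using dnz Cons.prems(3) by (meson linorder_cases)
  qed
  obtain e where e: "e > 0" "\<And>h. 0 < h \<Longrightarrow> h < e \<Longrightarrow> (poly p (x + h) < 0 \<longleftrightarrow> poly (pderiv p) x < 0) \<and> poly p (x + h) \<noteq> 0"
  proof (cases "poly (pderiv p) x > 0")
    case True
    from DERIV_pos_inc_right[OF d True] obtain e where e: "e > 0" "\<And>h. 0 < h \<Longrightarrow> h < e \<Longrightarrow> poly p x < poly p (x + h)"
      by blast
    show ?thesis by (rule that[OF e(1)]) (use e(2) True in \<open>fastforce simp: x(2)\<close>)
  next
    case False
    with dnz have neg: "poly (pderiv p) x < 0" by simp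
    from DERIV_neg_dec_right[OF d neg] obtain e where e: "e > 0" "\<And>h. 0 < h \<Longrightarrow> h < e \<Longrightarrow> poly p x > poly p (x + h)"
      by blast
    show ?thesis by (rule that[OF e(1)]) (use e(2) neg in \<open>fastforce simp: x(2)\<close>)
  qed
  \<comment> \<open>\<open>x + h\<close> is the base point for the remaining roots: it lies within
    the radius \<open>e\<close> where the sign is known, and at most half way to any later root.
    Inserting \<open>e/2\<close> also keeps the set nonempty.\<close>
  define h where "h = Min (insert (e/2) ((\<lambda>y. (y - x)/2) ` set xs))"
  have h: "h > 0" unfolding h_def using Cons.prems(1) e(1) by simp
  have "h \<le> e/2" unfolding h_def by (rule Min_le) auto
  then have he: "h < e" using e(1) by simp
  have hy: "x + h < y" if "y \<in> set xs" for y
  proof -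
    have "h \<le> (y - x)/2" unfolding h_def by (rule Min_le) (use that in auto)
    moreover have "x < y" using that Cons.prems(1) by auto
    ultimately show ?thesis by (simp add: field_simps)
  qed
  have "set xs = {y. x + h < y \<and> poly p y = 0}"
  proof
    show "set xs \<subseteq> {y. x + h < y \<and> poly p y = 0}"
      using hy Cons.prems(2) by auto
    show "{y. x + h < y \<and> poly p y = 0} \<subseteq> set xs"
    proof
      fix y assume "y \<in> {y. x + h < y \<and> poly p y = 0}"
      then have "y \<in> set (x # xs)" "y \<noteq> x" unfolding Cons.prems(2) using x h by auto
      then show "y \<in> set xs" by simp
    qed
  qed
  moreover have "sorted_wrt (<) xs" using Cons.prems(1) by simp
  ultimately have "alternating (poly p (x + h) < 0) (map lab xs)"
    using Cons.IH e(2)[OF h he] by blast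
  moreover have "(poly p (x + h) < 0) = (\<not> poly p a < 0)" using e(2)[OF h he] sgn dnz by auto
  ultimately show ?case using lab[OF x(2)] sgn by simp
qed

text \<open>The edge relation times D = B C reads c0 A N B C = W D - (2t/3) D^2 with deg W at most
  deg D. The last term dominates, and its sign cancels that of the negative c0.\<close>

lemma edge_product_lead:
  assumes "edge A N B C" "B \<noteq> 0" "C \<noteq> 0"
  shows "lead_coeff (A * N * B * C) > 0" "odd (degree (A * N * B * C))"
proof -
  define D where "D = B * C"
  define W where "W = pderiv B * C - B * pderiv C"
  have D: "D \<noteq> 0" using assms by (simp add: D_def)
  have "degree (pderiv B * C) \<le> degree D" "degree (B * pderiv C) \<le> degree D"
    using assms degree_mult_le[of "pderiv B" C] degree_mult_le[of B "pderiv C"]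
    by (auto simp: D_def degree_mult_eq degree_pderiv)
  then have "degree W \<le> degree D" unfolding W_def by (rule degree_diff_le)
  then have W: "degree (W * D) \<le> 2 * degree D" using degree_mult_le[of W D] by simp
  have sq: "degree (D * D) = 2 * degree D" using D by (simp add: degree_mult_eq)
  have sq': "lead_coeff (D * D) = lead_coeff D ^ 2" by (simp only: lead_coeff_mult power2_eq_square)
  have T: "degree ([:0, 2/3:] * (D * D)) = 2 * degree D + 1"
    using D sq by (simp add: degree_mult_eq)
  have T': "lead_coeff (- ([:0, 2/3:] * (D * D))) = - (2/3) * lead_coeff D ^ 2"
    unfolding lead_coeff_minus lead_coeff_mult[of "[:0, 2/3:]"] sq' by simp
  have eq: "[:- (sqrt 2 / 3):] * (A * N * B * C) = W * D + - ([:0, 2/3:] * (D * D))"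
  proof -
    have ring: "(W - T * B * C) * D = W * D + - (T * (D * D))" for T
      by (simp add: D_def algebra_simps)
    have "k * (A * N * B * C) = (k * (A * N)) * D" for k
      by (simp add: D_def mult_ac)
    then have "[:- (sqrt 2 / 3):] * (A * N * B * C) = ([:- (sqrt 2 / 3):] * (A * N)) * D" .
    also have "\<dots> = W * D + - ([:0, 2/3:] * (D * D))"
      unfolding assms(1)[unfolded edge_def, symmetric] W_def[symmetric] by (rule ring)
    finally show ?thesis .
  qed
  have "degree (W * D) < degree (- ([:0, 2/3:] * (D * D)))" using W T by (simp only: degree_minus)
  note lt = this
  have "degree ([:- (sqrt 2 / 3):] * (A * N * B * C)) = 2 * degree D + 1"
    unfolding eq degree_add_eq_right[OF lt] degree_minus by (rule T)
  then have dg: "degree (A * N * B * C) = 2 * degree D + 1" by simp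
  have "lead_coeff ([:- (sqrt 2 / 3):] * (A * N * B * C)) = - (2/3) * lead_coeff D ^ 2"
    unfolding eq using lead_coeff_add_le[OF lt] T' by (simp only: )
  then have "(sqrt 2 / 3) * lead_coeff (A * N * B * C) = (2/3) * lead_coeff D ^ 2"
    unfolding lead_coeff_mult by simp
  moreover have "(2/3) * lead_coeff D ^ 2 > 0" using D by simp
  ultimately have "(sqrt 2 / 3) * lead_coeff (A * N * B * C) > 0" by (simp only: )
  then show "lead_coeff (A * N * B * C) > 0" by (simp only: zero_less_mult_iff) simp
  show "odd (degree (A * N * B * C))" unfolding dg by simp
qed

lemma odd_degree_end_signs:
  fixes p :: "real poly"
  assumes "lead_coeff p > 0" "odd (degree p)"
  obtains K where "\<And>x. x \<ge> K \<Longrightarrow> poly p x > 0" "\<And>x. x \<le> - K \<Longrightarrow> poly p x < 0"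
proof -
  \<comment> \<open>The polynomial - p(- x) has positive leading coefficient because the degree is
    odd; at plus infinity it shows how \<open>p\<close> behaves at minus infinity.\<close>
  let ?r = "- pcompose p [:0, -1:]"
  have "lead_coeff ?r > 0"
    using assms lead_coeff_comp[of "[:0,-1:]" p] by (simp add: lead_coeff_minus)
  from poly_pinfty_gt_lc[OF this] obtain K1 where K1: "\<And>x. x \<ge> K1 \<Longrightarrow> poly ?r x \<ge> lead_coeff ?r" by auto
  from poly_pinfty_gt_lc[OF assms(1)] obtain K2 where K2: "\<And>x. x \<ge> K2 \<Longrightarrow> poly p x \<ge> lead_coeff p" by auto
  show ?thesis
  proof (rule that[of "max K1 K2"])
    show "poly p x > 0" if "x \<ge> max K1 K2" for x using K2[of x] that assms(1) by simp
    show "poly p x < 0" if "x \<le> - max K1 K2" for x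
      using K1[of "-x"] that \<open>lead_coeff ?r > 0\<close> by (simp add: poly_pcompose) linarith
  qed
qed

text \<open>For every rhombus the letters are used as for the function f_A of its edge B C, also when that
  edge is not horizontal: N gives Zp, A gives Zm, B gives Pp and C gives Pm.\<close>

definition root_label :: "real poly \<Rightarrow> real poly \<Rightarrow> real poly \<Rightarrow> real \<Rightarrow> sing" where
  "root_label A N B x = (if poly N x = 0 then Zp else if poly A x = 0 then Zm
     else if poly B x = 0 then Pp else Pm)"

definition root_word :: "real poly \<Rightarrow> real poly \<Rightarrow> real poly \<Rightarrow> real poly \<Rightarrow> sing list" where
  "root_word A N B C = map (root_label A N B) (sorted_list_of_set {x. poly (A * N * B * C) x = 0})"

lemma root_word_alternating:
  assumes tr: "triangle A B C a b c" and ed: "edge A N B C" and k: "b - c + 2/3 > 0"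
  shows "alternating True (root_word A N B C)"
proof -
  let ?p = "A * N * B * C"
  note tr' = triangle_reflect[OF tr ed k] and co = reflect_coprime[OF tr ed k]
  have nz: "B \<noteq> 0" "C \<noteq> 0" "?p \<noteq> 0" using tr tr' by (auto simp: triangle_def)
  \<comment> \<open>A N B C has the opposite sign to f_A = const * A N / (B C), so f_A falls where its derivative is positive.\<close>
  have d: "(falling (root_label A N B x) \<longleftrightarrow> poly (pderiv ?p) x > 0) \<and> poly (pderiv ?p) x \<noteq> 0"
    if "poly ?p x = 0" for x
  proof -
    let ?A = "poly A x" and ?B = "poly B x" and ?C = "poly C x" and ?N = "poly N x"
    let ?A1 = "poly (pderiv A) x" and ?B1 = "poly (pderiv B) x" and ?C1 = "poly (pderiv C) x" and ?N1 = "poly (pderiv N) x"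
    have dp: "poly (pderiv ?p) x = ?A1*?N*?B*?C + ?A*?N1*?B*?C + ?A*?N*?B1*?C + ?A*?N*?B*?C1"
      by (simp add: pderiv_mult algebra_simps)
    define s :: real where "s = sqrt 2 / 3"
    have s: "s > 0" by (simp add: s_def)
    have wp: "- s * (?A1 * ?N - ?A * ?N1) = (b - c + 2/3) * ?B * ?C"
      unfolding s_def by (rule wronskian_poly[OF tr ed])
    have ep: "?B1 * ?C - ?B * ?C1 - (2/3) * x * ?B * ?C = - s * (?A * ?N)"
      unfolding s_def by (rule edge_poly[OF ed])
    have cop: "?A = 0 \<Longrightarrow> ?N \<noteq> 0" "?N = 0 \<Longrightarrow> ?B \<noteq> 0" "?A = 0 \<Longrightarrow> ?B \<noteq> 0"
      "?B = 0 \<Longrightarrow> ?C \<noteq> 0" "?C = 0 \<Longrightarrow> ?A \<noteq> 0" "?C = 0 \<Longrightarrow> ?N \<noteq> 0"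
      using tr tr' co unfolding triangle_def no_common_root_def by blast+
    from that consider "?N = 0" "?A \<noteq> 0" "?B \<noteq> 0" "?C \<noteq> 0" | "?A = 0" "?N \<noteq> 0" "?B \<noteq> 0" "?C \<noteq> 0"
      | "?B = 0" "?A \<noteq> 0" "?N \<noteq> 0" "?C \<noteq> 0" | "?C = 0" "?A \<noteq> 0" "?N \<noteq> 0" "?B \<noteq> 0"
      using cop unfolding poly_mult mult_eq_0_iff by blast
    then show ?thesis
    proof cases
      case 1
      \<comment> \<open>Only A N' B C survives in the derivative; multiplying the Wronskian relation
        by B C makes it a positive multiple of a square.\<close>
      have "s * poly (pderiv ?p) x = (b - c + 2/3) * (?B * ?C)\<^sup>2"
        unfolding dp using arg_cong[OF wp, of "\<lambda>z. z * (?B * ?C)"] 1 by (simp add: power2_eq_square mult_ac)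
      also have "\<dots> > 0" using k 1 by simp
      finally have "poly (pderiv ?p) x > 0" using s by (simp add: zero_less_mult_iff)
      then show ?thesis using 1 by (simp add: root_label_def)
    next
      case 2
      have "s * - poly (pderiv ?p) x = (b - c + 2/3) * (?B * ?C)\<^sup>2"
        unfolding dp using arg_cong[OF wp, of "\<lambda>z. z * (?B * ?C)"] 2 by (simp add: power2_eq_square mult_ac)
      also have "\<dots> > 0" using k 2 by simp
      finally have "poly (pderiv ?p) x < 0" using s by (simp add: mult_less_0_iff)
      then show ?thesis using 2 by (simp add: root_label_def)
    next
      case 3
      have b1: "?B1 \<noteq> 0" using tr 3 by (auto simp: triangle_def real_roots_simple_def)
      \<comment> \<open>At a root of B the edge relation becomes s A N = - B' C, which turns the
        surviving term A N B' C into minus a square.\<close>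
      have e: "s * (?A * ?N) = - (?B1 * ?C)" using ep 3 by simp
      have "s * - poly (pderiv ?p) x = - (s * (?A * ?N)) * (?B1 * ?C)" unfolding dp using 3 by simp
      then have "s * - poly (pderiv ?p) x = (?B1 * ?C)\<^sup>2" unfolding e by (simp add: power2_eq_square)
      moreover have "(?B1 * ?C)\<^sup>2 > 0" using b1 3 by simp
      ultimately have "s * - poly (pderiv ?p) x > 0" by (simp only:)
      then have "poly (pderiv ?p) x < 0" using s by (simp add: mult_less_0_iff)
      then show ?thesis using 3 by (simp add: root_label_def)
    next
      case 4
      have c1: "?C1 \<noteq> 0" using tr 4 by (auto simp: triangle_def real_roots_simple_def)
      have e: "s * (?A * ?N) =  (?B * ?C1)" using ep 4 by simp
      have "s * poly (pderiv ?p) x =  (s * (?A * ?N)) * (?B * ?C1)" unfolding dp using 4 by simp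
      then have "s * poly (pderiv ?p) x = (?B * ?C1)\<^sup>2" unfolding e by (simp add: power2_eq_square)
      moreover have "(?B * ?C1)\<^sup>2 > 0" using c1 4 by simp
      ultimately have "s * poly (pderiv ?p) x > 0" by (simp only:)
      then have "poly (pderiv ?p) x > 0" using s by (simp add: zero_less_mult_iff)
      then show ?thesis using 4 by (simp add: root_label_def)
    qed
  qed
  \<comment> \<open>The base point - K lies left of all roots, and the product is negative there:
    f_A starts out positive.\<close>
  obtain K where K: "\<And>x. x \<ge> K \<Longrightarrow> poly ?p x > 0" "\<And>x. x \<le> - K \<Longrightarrow> poly ?p x < 0"
    using odd_degree_end_signs[OF edge_product_lead[OF ed nz(1,2)]] by blast
  have fin: "finite {x. poly ?p x = 0}" using nz(3) by (rule poly_roots_finite)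
  have roots: "{x. poly ?p x = 0} = {x. - K < x \<and> poly ?p x = 0}"
  proof -
    have "- K < x" if "poly ?p x = 0" for x
    proof (rule ccontr)
      assume "\<not> - K < x"
      then have "x \<le> - K" by (simp only: not_less)
      from K(2)[OF this] that show False by (simp only: less_irrefl)
    qed
    then show ?thesis by blast
  qed
  have "alternating (poly ?p (- K) < 0) (root_word A N B C)"
    unfolding root_word_def
  proof (rule root_derivative_alternating[where p = ?p and K = K])
    show "set (sorted_list_of_set {x. poly ?p x = 0}) = {x. - K < x \<and> poly ?p x = 0}"
      unfolding set_sorted_list_of_set[OF fin] by (rule roots)
    show "poly ?p (- K) \<noteq> 0" using K(2)[of "-K"] by linarith
    show "sorted_wrt (<) (sorted_list_of_set {x. poly ?p x = 0})" by simp
  qed (use d K(1) in blast)+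
  then show ?thesis using K(2)[of "-K"] by simp
qed

lemma filter_sorted_list_of_set:
  assumes "finite (S :: 'a::linorder set)"
  shows "filter P (sorted_list_of_set S) = sorted_list_of_set {x \<in> S. P x}"
proof (rule sorted_distinct_set_unique)
  show "sorted (filter P (sorted_list_of_set S))" by (simp add: sorted_wrt_filter)
qed (use assms in simp_all)

section \<open>Propagation over the lattice\<close>

text \<open>The sign covers even and odd polynomials together; either way the roots are symmetric
  about 0, which will locate the marked letter.\<close>

definition has_parity :: "real poly \<Rightarrow> bool" where
  "has_parity p \<longleftrightarrow> (\<exists>s\<in>{1, -1}. pcompose p [:0, -1:] = smult s p)"

text \<open>The right side of the recurrence is even whether \<open>p\<close> is even or odd, so M N
  is even and N inherits the parity of M.\<close>

lemma has_parity_toda: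
  assumes "toda M N p k" "has_parity M" "has_parity p" "M \<noteq> 0"
  shows "has_parity N"
proof -
  let ?R = "\<lambda>q::real poly. pcompose q [:0, -1:]"
  obtain s where s: "s = 1 \<or> s = -1" "?R p = smult s p" using assms(3) unfolding has_parity_def by blast
  obtain r where r: "r = 1 \<or> r = -1" "?R M = smult r M" using assms(2) unfolding has_parity_def by blast
  have d: "?R (pderiv q) = - pderiv (?R q)" for q
    by (simp add: pderiv_pcompose pderiv_pCons)
  have d1: "?R (pderiv p) = smult (- s) (pderiv p)"
    by (simp add: d s(2) pderiv_smult)
  have d2: "?R (pderiv (pderiv p)) = smult s (pderiv (pderiv p))"
    by (simp add: d s(2) pderiv_smult pderiv_minus)
  have ss: "s * s = 1" "r * r = 1" using s r by auto
  have e: "?R [:(9/2) * k, 0, 2:] = [:(9/2) * k, 0, 2:]" by (simp add: pcompose_pCons)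
  have "?R (M * N) = M * N"
    unfolding assms(1)[unfolded toda_def]
    by (simp only: pcompose_add pcompose_smult pcompose_diff pcompose_mult power2_eq_square d1 d2 s(2) e
       mult_smult_left mult_smult_right smult_smult) (simp add: ss)
  then have "smult r M * ?R N = M * N" by (simp add: pcompose_mult r(2))
  then have "M * smult r (?R N) = M * N" by simp
  then have "smult r (?R N) = N" using assms(4) by (simp only: mult_cancel_left) simp
  then have "smult r (smult r (?R N)) = smult r N" by simp
  then have "?R N = smult r N" by (simp add: ss)
  with r(1) show ?thesis by (auto simp: has_parity_def)
qed

section \<open>Rhombi and the passage to a neighbouring rhombus\<close>

text \<open>\<open>b - c + 2/3\<close> is the Wronskian constant of A and N; on the horizontal edges
  it will equal -2 a1.\<close>

definition rhombus where
  "rhombus A N B C a b c w \<longleftrightarrow> triangle A B C a b c \<and> edge A N B C \<and> b - c + 2/3 > 0 \<and>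
     has_parity A \<and> has_parity N \<and> has_parity B \<and> has_parity C \<and> root_word A N B C = w"

text \<open>Passing from the rhombus A N B C to the one over the edge N B (opposite vertex C), respectively
  C N (opposite vertex B). Roots of A disappear, so the image of Zm is irrelevant.\<close>

fun relabel1 :: "sing \<Rightarrow> sing" where
  "relabel1 Zp = Pp" | "relabel1 Pp = Pm" | "relabel1 Pm = Zm" | "relabel1 Zm = Zp"

fun relabel2 :: "sing \<Rightarrow> sing" where
  "relabel2 Zp = Pm" | "relabel2 Pm = Pp" | "relabel2 Pp = Zm" | "relabel2 Zm = Zp"

text \<open>Meant for two rhombi with three common vertices: without the vertex that is left behind
  (\<open>Zm\<close>) and the new one (\<open>Zp\<close>), both words list the same roots in the
  same order, renamed by \<open>f\<close>.\<close>

lemma root_word_step: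
  assumes nz: "A * N * B * C \<noteq> 0" "A' * N' * B' * C' \<noteq> 0"
    and S: "\<And>x. (poly (A' * N' * B' * C') x = 0 \<and> root_label A' N' B' x \<noteq> Zp) \<longleftrightarrow>
              (poly (A * N * B * C) x = 0 \<and> root_label A N B x \<noteq> Zm)"
    and lab: "\<And>x. poly (A * N * B * C) x = 0 \<Longrightarrow> root_label A N B x \<noteq> Zm \<Longrightarrow>
              root_label A' N' B' x = f (root_label A N B x)"
  shows "filter (\<lambda>c. c \<noteq> Zp) (root_word A' N' B' C') = map f (filter (\<lambda>c. c \<noteq> Zm) (root_word A N B C))"
proof -
  let ?S = "{x. poly (A * N * B * C) x = 0}" and ?S' = "{x. poly (A' * N' * B' * C') x = 0}"
  let ?l = "root_label A N B" and ?l' = "root_label A' N' B'"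
  have fin: "finite ?S" "finite ?S'" by (rule poly_roots_finite[OF nz(1)], rule poly_roots_finite[OF nz(2)])
  have eq: "{x \<in> ?S'. ?l' x \<noteq> Zp} = {x \<in> ?S. ?l x \<noteq> Zm}" using S by blast
  have fin': "finite {x \<in> ?S. ?l x \<noteq> Zm}" using fin(1) by simp
  have "filter (\<lambda>c. c \<noteq> Zp) (root_word A' N' B' C') = map ?l' (sorted_list_of_set {x \<in> ?S'. ?l' x \<noteq> Zp})"
    unfolding root_word_def filter_map comp_def filter_sorted_list_of_set[OF fin(2)] ..
  also have "\<dots> = map (f \<circ> ?l) (sorted_list_of_set {x \<in> ?S. ?l x \<noteq> Zm})"
    unfolding eq map_eq_conv set_sorted_list_of_set[OF fin'] using lab by auto
  also have "\<dots> = map f (map ?l (filter (\<lambda>x. ?l x \<noteq> Zm) (sorted_list_of_set ?S)))"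
    unfolding map_map filter_sorted_list_of_set[OF fin(1)] ..
  also have "\<dots> = map f (filter (\<lambda>c. c \<noteq> Zm) (root_word A N B C))"
    unfolding root_word_def filter_map comp_def ..
  finally show ?thesis .
qed

lemma rhombus_facts:
  assumes "triangle A B C a b c" "edge A N B C" "b - c + 2/3 > 0"
  shows "A * N * B * C \<noteq> 0"
    and "poly A x = 0 \<Longrightarrow> poly N x \<noteq> 0 \<and> poly B x \<noteq> 0 \<and> poly C x \<noteq> 0"
    and "poly N x = 0 \<Longrightarrow> poly A x \<noteq> 0 \<and> poly B x \<noteq> 0 \<and> poly C x \<noteq> 0"
    and "poly B x = 0 \<Longrightarrow> poly A x \<noteq> 0 \<and> poly N x \<noteq> 0 \<and> poly C x \<noteq> 0"
    and "poly C x = 0 \<Longrightarrow> poly A x \<noteq> 0 \<and> poly N x \<noteq> 0 \<and> poly B x \<noteq> 0"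
proof -
  note t = assms(1) triangle_reflect[OF assms] reflect_coprime[OF assms]
  show "A * N * B * C \<noteq> 0" using t by (auto simp: triangle_def)
  have "no_common_root A B" "no_common_root B C" "no_common_root C A" "no_common_root N B" "no_common_root C N"
    "no_common_root A N" using t by (simp_all add: triangle_def)
  then show "poly A x = 0 \<Longrightarrow> poly N x \<noteq> 0 \<and> poly B x \<noteq> 0 \<and> poly C x \<noteq> 0"
    "poly N x = 0 \<Longrightarrow> poly A x \<noteq> 0 \<and> poly B x \<noteq> 0 \<and> poly C x \<noteq> 0"
    "poly B x = 0 \<Longrightarrow> poly A x \<noteq> 0 \<and> poly N x \<noteq> 0 \<and> poly C x \<noteq> 0"
    "poly C x = 0 \<Longrightarrow> poly A x \<noteq> 0 \<and> poly N x \<noteq> 0 \<and> poly B x \<noteq> 0"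
    unfolding no_common_root_def by blast+
qed

text \<open>The Toda relation through A, B, N' supplies the vertex opposite C across the edge N B.
  The word \<open>w'\<close> enters as a candidate: being alternating and having the right letters
  other than \<open>Zp\<close> identifies it.\<close>

lemma rhombus_step1:
  assumes rh: "rhombus A N B C a b c w" and a': "a' = b + 2/3" and c': "c' = c - 2/3"
    and k: "a - c' + 2/3 > 0" and to: "toda A N' B c'"
    and w: "alternating True w'" "filter (\<lambda>c. c \<noteq> Zp) w' = map relabel1 (filter (\<lambda>c. c \<noteq> Zm) w)"
  shows "rhombus C N' N B a' a c' w'"
proof -
  have tr: "triangle A B C a b c" and ed: "edge A N B C" and k0: "b - c + 2/3 > 0"
    and par: "has_parity A" "has_parity N" "has_parity B" "has_parity C"
    and w0: "root_word A N B C = w" using rh by (auto simp: rhombus_def)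
  note tr' = triangle_reflect[OF tr ed k0]
  have tr2: "triangle C N B a' a c'" using triangle_rotate[OF triangle_rotate[OF tr']] a' c' by simp
  have ed2: "edge C N' N B"
    \<comment> \<open>In the triangle C N B the vertex A is the reflection of N, so the old edge
      relation serves with \<open>A\<close> as \<open>M\<close>.\<close>
    by (rule edge_of_toda[OF _ ed to]) (use tr tr' c' in \<open>auto simp: triangle_def\<close>)
  have par2: "has_parity N'" using has_parity_toda[OF to par(1,3)] tr by (simp add: triangle_def)
  note f = rhombus_facts[OF tr ed k0] and f2 = rhombus_facts[OF tr2 ed2 k]
  have "filter (\<lambda>c. c \<noteq> Zp) (root_word C N' N B) = map relabel1 (filter (\<lambda>c. c \<noteq> Zm) (root_word A N B C))"
  proof (rule root_word_step[OF f(1) f2(1)])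
    fix x
    have iff: "(poly (C * N' * N * B) x = 0 \<and> root_label C N' N x \<noteq> Zp) \<longleftrightarrow>
              (poly (A * N * B * C) x = 0 \<and> root_label A N B x \<noteq> Zm)" (is ?iff)
      and lab: "root_label A N B x \<noteq> Zm \<longrightarrow> poly (A * N * B * C) x = 0 \<longrightarrow>
              root_label C N' N x = relabel1 (root_label A N B x)" (is ?lab)
    proof -
      consider "poly N x = 0" | "poly B x = 0" | "poly C x = 0"
        | "poly N x \<noteq> 0" "poly B x \<noteq> 0" "poly C x \<noteq> 0" by blast
      then have "?iff \<and> ?lab"
      proof cases
        case 1
        then show ?thesis using f(3)[OF 1] f2(4)[OF 1] by (simp add: root_label_def)
      next
        case 2
        then show ?thesis using f(4)[OF 2] f2(5)[OF 2] by (simp add: root_label_def)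
      next
        case 3
        then show ?thesis using f(5)[OF 3] f2(2)[OF 3] by (simp add: root_label_def)
      next
        case 4
        then show ?thesis by (simp add: root_label_def)
      qed
      then show ?iff ?lab by blast+
    qed
    show "(poly (C * N' * N * B) x = 0 \<and> root_label C N' N x \<noteq> Zp) \<longleftrightarrow>
              (poly (A * N * B * C) x = 0 \<and> root_label A N B x \<noteq> Zm)" by (rule iff)
    show "root_label C N' N x = relabel1 (root_label A N B x)"
      if "poly (A * N * B * C) x = 0" "root_label A N B x \<noteq> Zm"
      using lab that by blast
  qed
  then have "root_word C N' N B = w'"
    using alternating_unique[OF root_word_alternating[OF tr2 ed2 k] w(1)] w(2) w0 by simp
  with tr2 ed2 k par par2 show ?thesis by (simp add: rhombus_def)
qed

text \<open>The counterpart across the edge C N, with the Toda relation through A, C, N'.\<close>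

lemma rhombus_step2:
  assumes rh: "rhombus A N B C a b c w" and a': "a' = c - 2/3" and b': "b' = b + 2/3"
    and k: "b' - a + 2/3 > 0" and to: "toda A N' C b'"
    and w: "alternating True w'" "filter (\<lambda>c. c \<noteq> Zp) w' = map relabel2 (filter (\<lambda>c. c \<noteq> Zm) w)"
  shows "rhombus B N' C N a' b' a w'"
proof -
  have tr: "triangle A B C a b c" and ed: "edge A N B C" and k0: "b - c + 2/3 > 0"
    and par: "has_parity A" "has_parity N" "has_parity B" "has_parity C"
    and w0: "root_word A N B C = w" using rh by (auto simp: rhombus_def)
  note tr' = triangle_reflect[OF tr ed k0]
  have tr2: "triangle B C N a' b' a" using triangle_rotate[OF tr'] a' b' by simp
  have ed2: "edge B N' C N"
    by (rule edge_of_toda'[OF _ ed to]) (use tr tr' b' in \<open>auto simp: triangle_def\<close>)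
  have par2: "has_parity N'" using has_parity_toda[OF to par(1,4)] tr by (simp add: triangle_def)
  note f = rhombus_facts[OF tr ed k0] and f2 = rhombus_facts[OF tr2 ed2 k]
  have "filter (\<lambda>c. c \<noteq> Zp) (root_word B N' C N) = map relabel2 (filter (\<lambda>c. c \<noteq> Zm) (root_word A N B C))"
  proof (rule root_word_step[OF f(1) f2(1)])
    fix x
    have iff: "(poly (B * N' * C * N) x = 0 \<and> root_label B N' C x \<noteq> Zp) \<longleftrightarrow>
              (poly (A * N * B * C) x = 0 \<and> root_label A N B x \<noteq> Zm)" (is ?iff)
      and lab: "root_label A N B x \<noteq> Zm \<longrightarrow> poly (A * N * B * C) x = 0 \<longrightarrow>
              root_label B N' C x = relabel2 (root_label A N B x)" (is ?lab)
    proof -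
      consider "poly N x = 0" | "poly B x = 0" | "poly C x = 0"
        | "poly N x \<noteq> 0" "poly B x \<noteq> 0" "poly C x \<noteq> 0" by blast
      then have "?iff \<and> ?lab"
      proof cases
        case 1
        then show ?thesis using f(3)[OF 1] f2(5)[OF 1] by (simp add: root_label_def)
      next
        case 2
        then show ?thesis using f(4)[OF 2] f2(2)[OF 2] by (simp add: root_label_def)
      next
        case 3
        then show ?thesis using f(5)[OF 3] f2(4)[OF 3] by (simp add: root_label_def)
      next
        case 4
        then show ?thesis by (simp add: root_label_def)
      qed
      then show ?iff ?lab by blast+
    qed
    show "(poly (B * N' * C * N) x = 0 \<and> root_label B N' C x \<noteq> Zp) \<longleftrightarrow>
              (poly (A * N * B * C) x = 0 \<and> root_label A N B x \<noteq> Zm)" by (rule iff)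
    show "root_label B N' C x = relabel2 (root_label A N B x)"
      if "poly (A * N * B * C) x = 0" "root_label A N B x \<noteq> Zm"
      using lab that by blast
  qed
  then have "root_word B N' C N = w'"
    using alternating_unique[OF root_word_alternating[OF tr2 ed2 k] w(1)] w(2) w0 by simp
  with tr2 ed2 k par par2 show ?thesis by (simp add: rhombus_def)
qed

section \<open>Periodic words and their transformation under steps\<close>

lemma filter_wpow: "filter P (wpow w k) = wpow (filter P w) k"
  by (induction k) (simp_all add: wpow_def)

lemma map_wpow: "map f (wpow w k) = wpow (map f w) k"
  by (induction k) (simp_all add: wpow_def)

lemma length_wpow: "length (wpow w k) = length w * k"
  by (induction k) (simp_all add: wpow_def)

lemma wpow_0 [simp]: "wpow w 0 = []" and wpow_Suc: "wpow w (Suc k) = w @ wpow w k"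
  by (simp_all add: wpow_def)

lemma wpow_Suc_right: "wpow w (Suc k) = wpow w k @ w"
  by (induction k) (simp_all add: wpow_Suc)

lemma wpow_add: "wpow w (j + k) = wpow w j @ wpow w k"
  by (induction j) (simp_all add: wpow_Suc)

lemma wpow_rotate: "wpow (c # w) k @ c # v = c # wpow (w @ [c]) k @ v"
  by (induction k) (simp_all add: wpow_Suc)

lemma alternating_wpow:
  assumes "\<And>u. alternating b (w @ u) = alternating b u"
  shows "alternating b (wpow w k @ v) = alternating b v"
  by (induction k) (simp_all add: wpow_Suc assms)

definition framed :: "nat \<Rightarrow> sing list \<Rightarrow> sing list" where
  "framed \<nu> w = wpow [Zp, Pp, Pm, Zm] \<nu> @ w @ wpow [Zm, Pm, Pp, Zp] \<nu>"

lemma framed_Suc: "framed (Suc \<nu>) w = framed \<nu> ([Zp, Pp, Pm, Zm] @ w @ [Zm, Pm, Pp, Zp])"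
proof -
  have "wpow [Zp, Pp, Pm, Zm] (Suc \<nu>) = wpow [Zp, Pp, Pm, Zm] \<nu> @ [Zp, Pp, Pm, Zm]"
    by (rule wpow_Suc_right)
  then show ?thesis by (simp add: framed_def wpow_Suc[of "[Zm, Pm, Pp, Zp]"])
qed

lemma alternating_framed:
  assumes "alternating True w"
  shows "alternating True (framed \<nu> w)"
  using alternating_wpow[of False "[Zm, Pm, Pp, Zp]" \<nu> "[]"]
  by (simp add: framed_def alternating_wpow alternating_append[OF assms])

text \<open>Both outer blocks reproduce themselves under a step: deleting \<open>Zm\<close> and
  relabelling gives the same letters as deleting \<open>Zp\<close>. Only the core needs
  checking.\<close>

lemma framed_step:
  assumes "filter (\<lambda>c. c \<noteq> Zp) w' = map relabel1 (filter (\<lambda>c. c \<noteq> Zm) w)"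
  shows "filter (\<lambda>c. c \<noteq> Zp) (framed \<nu> w') = map relabel1 (filter (\<lambda>c. c \<noteq> Zm) (framed \<nu> w))"
  by (simp add: framed_def filter_wpow map_wpow assms)

text \<open>The cores over diagonal (D) and horizontal (H) edges, met in the order D0, H1, D1, H2
  while climbing; \<open>k\<close> is the column index.\<close>

definition wordD0 where "wordD0 k = Zp # wpow [Pp, Zp] k"
definition wordH1 where "wordH1 k = Zp # wpow [Pp, Pm] k @ [Pp, Zp]"
definition wordD1 where "wordD1 k = [Zp, Pp] @ wpow [Pm, Zm] k @ [Pm, Pp, Zp]"
definition wordH2 where "wordH2 k = [Zp, Pp, Pm, Zm] @ wpow [Zp, Zm] k @ [Pm, Pp, Zp]"

lemmas words_def = wordD0_def wordH1_def wordD1_def wordH2_def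

lemma words_alternating:
  "alternating True (wordD0 k)" "alternating True (wordH1 k)"
  "alternating True (wordD1 k)" "alternating True (wordH2 k)"
  using alternating_wpow[of False "[Pp, Zp]" k "[]"]
  by (simp_all add: words_def alternating_wpow)

text \<open>Four steps close a cycle: D0 returns with one more outer block on each side.\<close>

lemma words_step:
  "filter (\<lambda>c. c \<noteq> Zp) (wordH1 k) = map relabel1 (filter (\<lambda>c. c \<noteq> Zm) (wordD0 k))"
  "filter (\<lambda>c. c \<noteq> Zp) (wordD1 k) = map relabel1 (filter (\<lambda>c. c \<noteq> Zm) (wordH1 k))"
  "filter (\<lambda>c. c \<noteq> Zp) (wordH2 k) = map relabel1 (filter (\<lambda>c. c \<noteq> Zm) (wordD1 k))"
  "filter (\<lambda>c. c \<noteq> Zp) ([Zp, Pp, Pm, Zm] @ wordD0 k @ [Zm, Pm, Pp, Zp]) = map relabel1 (filter (\<lambda>c. c \<noteq> Zm) (wordH2 k))"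
  using wpow_rotate[of Pp "[Pm]" k "[]"] wpow_rotate[of Zm "[]" k]
  by (simp_all add: words_def filter_wpow map_wpow)

section \<open>Okamoto polynomials on the third quadrant, indexed by natural numbers\<close>

definition okamoto_nat :: "(int \<Rightarrow> int \<Rightarrow> real poly) \<Rightarrow> nat \<Rightarrow> nat \<Rightarrow> real poly" where
  "okamoto_nat Q i j = Q (- int i) (- int j)"

text \<open>The recurrences centred at (- i, - (j + 1)) and (- (i + 1), - j), with constants
  multiplied by 2/9.\<close>

lemma okamoto_nat_toda:
  assumes "okamoto_family Q"
  shows "toda (okamoto_nat Q i j) (okamoto_nat Q i (j + 2)) (okamoto_nat Q i (j + 1)) (- (2/3) * (real i + 2 * real j + 1))"
    and "toda (okamoto_nat Q i j) (okamoto_nat Q (i + 2) j) (okamoto_nat Q (i + 1) j) ((2/3) * (2 * real i + real j + 1))"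
proof -
  have "Q m (n - 1) * Q m (n + 1) = smult (9/2) (pderiv (pderiv (Q m n)) * Q m n - (pderiv (Q m n))\<^sup>2)
          + [:of_int (3 * (m + 2 * n + 1)), 0, 2:] * (Q m n)\<^sup>2" if "m \<le> 0" "n \<le> -1" for m n
    using assms that by (auto simp: okamoto_family_def)
  from this[of "- int i" "- int (j + 1)"]
  show "toda (okamoto_nat Q i j) (okamoto_nat Q i (j + 2)) (okamoto_nat Q i (j + 1)) (- (2/3) * (real i + 2 * real j + 1))"
    by (simp add: toda_def okamoto_nat_def mult.commute algebra_simps)
  have "Q (m + 1) n * Q (m - 1) n = smult (9/2) (pderiv (pderiv (Q m n)) * Q m n - (pderiv (Q m n))\<^sup>2)
          + [:of_int (3 * (- 2 * m - n - 1)), 0, 2:] * (Q m n)\<^sup>2" if "m \<le> -1" "n \<le> 0" for m n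
    using assms that by (auto simp: okamoto_family_def)
  from this[of "- int (i + 1)" "- int j"]
  show "toda (okamoto_nat Q i j) (okamoto_nat Q (i + 2) j) (okamoto_nat Q (i + 1) j) ((2/3) * (2 * real i + real j + 1))"
    by (simp add: toda_def okamoto_nat_def mult.commute algebra_simps)
qed

text \<open>The rhombi over the edge from (m, n - 1) to (m - 1, n), respectively from (m - 1, n - 1) to
  (m, n - 1), where m = - i and n = - j. The latter is the one of q_(m,n-1).\<close>

definition diagonal_rhombus where
  "diagonal_rhombus P i j = rhombus (P i j) (P (i + 1) (j + 1)) (P i (j + 1)) (P (i + 1) j)
     ((2/3) * (real j - real i)) ((2/3) * (2 * real i + real j)) (- (2/3) * (real i + 2 * real j))"

definition horizontal_rhombus where
  "horizontal_rhombus P i j = rhombus (P (i + 1) j) (P i (j + 2)) (P (i + 1) (j + 1)) (P i (j + 1))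
     ((2/3) * (2 * real i + real j + 1)) ((2/3) * (real j - real i)) (- (2/3) * (real i + 2 * real j + 1))"

text \<open>Here f_A = -2t/3 and N = sqrt 2 t, which dictates the edge constant - sqrt 2 /
  3.\<close>

lemma diagonal_rhombus_0_0:
  assumes "okamoto_family Q"
  shows "diagonal_rhombus (okamoto_nat Q) 0 0 [Zp]"
proof -
  have Q: "okamoto_nat Q 0 0 = 1" "okamoto_nat Q 1 0 = 1" "okamoto_nat Q 0 1 = 1" "okamoto_nat Q 1 1 = [:0, sqrt 2:]"
    using assms by (simp_all add: okamoto_family_def okamoto_nat_def)
  have one: "has_parity 1" by (auto simp: has_parity_def pcompose_1)
  have par: "has_parity [:0, sqrt 2:]" by (auto simp: has_parity_def pcompose_pCons)
  have "root_word 1 [:0, sqrt 2:] 1 1 = [Zp]"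
    by (simp add: root_word_def root_label_def)
  with one par show ?thesis
    by (simp add: diagonal_rhombus_def Q[simplified] rhombus_def triangle_def trilinear_def edge_def pderiv_1
        real_roots_simple_def no_common_root_def)
qed

text \<open>Two steps of the second kind move one column on, crossing the vertical edge from (i + 1,
  0) to (i + 1, 1).\<close>

lemma diagonal_rhombus_Suc_0:
  assumes fam: "okamoto_family Q" and rh: "diagonal_rhombus (okamoto_nat Q) i 0 (wordD0 i)"
  shows "diagonal_rhombus (okamoto_nat Q) (i + 1) 0 (wordD0 (i + 1))"
proof -
  let ?P = "okamoto_nat Q"
  \<comment> \<open>The word over the vertical edge. It contains no \<open>Zp\<close>: the new
    vertex at (i + 2, 0) has no real roots.\<close>
  let ?v = "Pm # wpow [Zm, Pm] i"
  have alt: "alternating True ?v"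
    using alternating_wpow[of False "[Zm, Pm]" i "[]"] by simp
  have 1: "rhombus (?P i 1) (?P (i + 2) 0) (?P (i + 1) 0) (?P (i + 1) 1)
     (- (2/3) * (real i + 1)) ((2/3) * (2 * real i + real 0 + 1)) ((2/3) * (real 0 - real i)) ?v"
    by (rule rhombus_step2[OF rh[unfolded diagonal_rhombus_def add_0] _ _ _ okamoto_nat_toda(2)[OF fam] alt])
      (simp_all add: wordD0_def filter_wpow map_wpow field_simps)
  have k: "(2/3) * (2 * real i + real 1 + 1) - (- (2/3) * (real i + 1)) + 2/3 > 0"
    by (simp add: algebra_simps add_nonneg_pos)
  have 2: "rhombus (?P (i + 1) 0) (?P (i + 2) 1) (?P (i + 1) 1) (?P (i + 2) 0)
     ((2/3) * (real 0 - real (i + 1))) ((2/3) * (2 * real i + real 1 + 1)) (- (2/3) * (real i + 1))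
     (wordD0 (i + 1))"
    by (rule rhombus_step2[OF 1 _ _ k okamoto_nat_toda(2)[OF fam, of i 1] words_alternating(1)])
      (simp_all add: wordD0_def filter_wpow map_wpow wpow_Suc)
  show ?thesis unfolding diagonal_rhombus_def using 2 by (simp add: algebra_simps)
qed

text \<open>A step of the first kind with the Toda relation in column \<open>i\<close>. The next
  step uses column \<open>i + 1\<close>, so alternating them climbs the strip between the two
  columns.\<close>

lemma horizontal_rhombus_of_diagonal_rhombus:
  assumes "okamoto_family Q" "diagonal_rhombus (okamoto_nat Q) i j w" "alternating True w'"
    "filter (\<lambda>c. c \<noteq> Zp) w' = map relabel1 (filter (\<lambda>c. c \<noteq> Zm) w)"
  shows "horizontal_rhombus (okamoto_nat Q) i j w'"
  unfolding horizontal_rhombus_def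
  by (rule rhombus_step1[OF assms(2)[unfolded diagonal_rhombus_def] _ _ _ okamoto_nat_toda(1)[OF assms(1)] assms(3,4)])
    (simp_all add: field_simps)

lemma diagonal_rhombus_of_horizontal_rhombus:
  assumes "okamoto_family Q" "horizontal_rhombus (okamoto_nat Q) i j w" "alternating True w'"
    "filter (\<lambda>c. c \<noteq> Zp) w' = map relabel1 (filter (\<lambda>c. c \<noteq> Zm) w)"
  shows "diagonal_rhombus (okamoto_nat Q) i (j + 1) w'"
proof -
  have "rhombus (okamoto_nat Q i (j + 1)) (okamoto_nat Q (i + 1) (j + 2)) (okamoto_nat Q i (j + 2)) (okamoto_nat Q (i + 1) (j + 1))
     ((2/3) * (real (j + 1) - real i)) ((2/3) * (2 * real i + real j + 1)) (- (2/3) * (real (i + 1) + 2 * real j + 1)) w'"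
    by (rule rhombus_step1[OF assms(2)[unfolded horizontal_rhombus_def] _ _ _ okamoto_nat_toda(1)[OF assms(1)] assms(3,4)])
      (simp_all add: field_simps)
  then show ?thesis unfolding diagonal_rhombus_def by (simp add: algebra_simps)
qed

lemma diagonal_rhombus_row_0:
  assumes "okamoto_family Q"
  shows "diagonal_rhombus (okamoto_nat Q) i 0 (wordD0 i)"
proof (induction i)
  case 0
  show ?case using diagonal_rhombus_0_0[OF assms] by (simp add: wordD0_def)
next
  case (Suc i)
  then show ?case using diagonal_rhombus_Suc_0[OF assms] by simp
qed

lemma horizontal_rhombus_words:
  assumes "okamoto_family Q"
  shows "horizontal_rhombus (okamoto_nat Q) i (2 * \<nu>) (framed \<nu> (wordH1 i))"
    and "horizontal_rhombus (okamoto_nat Q) i (2 * \<nu> + 1) (framed \<nu> (wordH2 i))"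
proof -
  note stepH = horizontal_rhombus_of_diagonal_rhombus[OF assms _ alternating_framed framed_step]
  note stepD = diagonal_rhombus_of_horizontal_rhombus[OF assms _ alternating_framed framed_step]
  have H1: "horizontal_rhombus (okamoto_nat Q) i (2 * \<nu>) (framed \<nu> (wordH1 i))"
    if "diagonal_rhombus (okamoto_nat Q) i (2 * \<nu>) (framed \<nu> (wordD0 i))" for \<nu>
    using stepH[OF that words_alternating(2) words_step(1)] .
  have H2: "horizontal_rhombus (okamoto_nat Q) i (2 * \<nu> + 1) (framed \<nu> (wordH2 i))"
    if "diagonal_rhombus (okamoto_nat Q) i (2 * \<nu>) (framed \<nu> (wordD0 i))" for \<nu>
    using stepH[OF stepD[OF H1[OF that] words_alternating(3) words_step(2)] words_alternating(4) words_step(3)] .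
  \<comment> \<open>The induction carries only the diagonal words in even rows; a full cycle of four
    steps raises the row by two.\<close>
  have D: "diagonal_rhombus (okamoto_nat Q) i (2 * \<nu>) (framed \<nu> (wordD0 i))" for \<nu>
  proof (induction \<nu>)
    case 0
    show ?case using diagonal_rhombus_row_0[OF assms] by (simp add: framed_def)
  next
    case (Suc \<nu>)
    have "alternating True ([Zp, Pp, Pm, Zm] @ wordD0 i @ [Zm, Pm, Pp, Zp])"
      using alternating_append[OF words_alternating(1)[of i]] by simp
    from stepD[OF H2[OF Suc] this words_step(4)] show ?case by (simp add: framed_Suc)
  qed
  show "horizontal_rhombus (okamoto_nat Q) i (2 * \<nu>) (framed \<nu> (wordH1 i))" by (rule H1[OF D])
  show "horizontal_rhombus (okamoto_nat Q) i (2 * \<nu> + 1) (framed \<nu> (wordH2 i))" by (rule H2[OF D])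
qed

section \<open>Signatures\<close>

lemma isCont_poly_quotient: "poly p x \<noteq> (0::real) \<Longrightarrow> isCont (\<lambda>s. poly r s / poly p s) x"
  by (intro continuous_intros) auto

lemma eventually_poly_nonzero: "poly p x \<noteq> (0::real) \<Longrightarrow> eventually (\<lambda>s. poly p s \<noteq> 0) (at x)"
  by (rule tendsto_imp_eventually_ne[OF poly_isCont[unfolded isCont_def]])

text \<open>With p = (s - x) u, the polynomial u - \<sigma> d also vanishes at x. A second factor s
  - x splits off, and the remaining quotient has a limit.\<close>

lemma simple_zero_expansion:
  fixes x \<sigma> :: real
  assumes eq: "\<And>s. poly d s \<noteq> 0 \<Longrightarrow> q s = poly p s / poly d s"
    and d: "poly d x \<noteq> 0" and p: "poly p x = 0" and p': "poly (pderiv p) x = \<sigma> * poly d x"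
  shows "(\<lambda>s. q s - \<sigma> * (s - x)) \<in> O[at x](\<lambda>s. (s - x)\<^sup>2)"
proof -
  obtain u where u: "p = [:- x, 1:] * u" using p unfolding poly_eq_0_iff_dvd by (rule dvdE)
  have "poly (u - smult \<sigma> d) x = 0" using p' unfolding u pderiv_mult by (simp add: pderiv_pCons)
  then have "[:- x, 1:] dvd u - smult \<sigma> d" by (simp only: poly_eq_0_iff_dvd)
  then obtain r where r: "u - smult \<sigma> d = [:- x, 1:] * r" by (rule dvdE)
  have ru: "poly u s - \<sigma> * poly d s = (s - x) * poly r s" for s
    using arg_cong[OF r, of "\<lambda>p. poly p s"] by (simp add: algebra_simps)
  have ev: "eventually (\<lambda>s. poly r s / poly d s = (q s - \<sigma> * (s - x)) / (s - x)\<^sup>2) (at x)"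
    using eventually_poly_nonzero[OF d] eventually_neq_at_within[of x x UNIV]
  proof eventually_elim
    case (elim s)
    have "q s - \<sigma> * (s - x) = (s - x) * (poly u s - \<sigma> * poly d s) / poly d s"
      using elim(1) unfolding eq[OF elim(1)] u by (simp add: field_simps)
    also have "\<dots> = (s - x)\<^sup>2 * (poly r s / poly d s)" unfolding ru by (simp add: power2_eq_square)
    finally show ?case using elim(2) by simp
  qed
  have "((\<lambda>s. poly r s / poly d s) \<longlongrightarrow> poly r x / poly d x) (at x)"
    using isCont_poly_quotient[OF d] by (simp add: isCont_def)
  then have "((\<lambda>s. (q s - \<sigma> * (s - x)) / (s - x)\<^sup>2) \<longlongrightarrow> poly r x / poly d x) (at x)"
    using ev by (rule Lim_transform_eventually)
  then show ?thesis
    by (rule bigoI_tendsto) (use eventually_neq_at_within[of x x UNIV] in \<open>simp add: eventually_mono\<close>)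
qed

text \<open>With p = (s - x) u, the difference is u'/u, which is continuous at x.\<close>

lemma log_derivative_expansion:
  assumes "poly p x = (0::real)" "poly (pderiv p) x \<noteq> 0"
  obtains L where "((\<lambda>s. poly (pderiv p) s / poly p s - 1 / (s - x)) \<longlongrightarrow> L) (at x)"
proof -
  obtain u where u: "p = [:- x, 1:] * u" using assms(1) unfolding poly_eq_0_iff_dvd by (rule dvdE)
  have ux: "poly u x \<noteq> 0" using assms(2) unfolding u pderiv_mult by (simp add: pderiv_pCons)
  have "((\<lambda>s. poly (pderiv u) s / poly u s) \<longlongrightarrow> poly (pderiv u) x / poly u x) (at x)"
    using isCont_poly_quotient[OF ux] by (simp add: isCont_def)
  moreover have "eventually (\<lambda>s. poly (pderiv u) s / poly u s = poly (pderiv p) s / poly p s - 1 / (s - x)) (at x)"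
    using eventually_poly_nonzero[OF ux] eventually_neq_at_within[of x x UNIV]
  proof eventually_elim
    case (elim s)
    have e: "poly (pderiv p) s = poly u s + (s - x) * poly (pderiv u) s" "poly p s = (s - x) * poly u s"
      unfolding u pderiv_mult by (simp_all add: pderiv_pCons algebra_simps)
    show ?case unfolding e using elim by (simp add: add_divide_distrib)
  qed
  ultimately show ?thesis by (rule that[OF Lim_transform_eventually])
qed

lemma pole_of_expansion:
  fixes q :: "real \<Rightarrow> real"
  assumes lim: "((\<lambda>s. q s - \<epsilon> / (s - x)) \<longlongrightarrow> L) (at x)" and "\<epsilon> \<noteq> 0"
  shows "is_real_pole q x" and "\<not> isCont q x" and "(\<lambda>s. q s - \<epsilon> / (s - x)) \<in> O[at x](\<lambda>_. 1)"
proof -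
  have "filterlim (\<lambda>s. s - x) (at 0) (at x)"
    by (intro filterlim_atI tendsto_eq_intros) (auto simp: eventually_at_filter)
  then have "filterlim (\<lambda>s. inverse (s - x)) at_infinity (at x)"
    by (rule filterlim_compose[OF filterlim_inverse_at_infinity])
  then have "filterlim (\<lambda>s. \<epsilon> * inverse (s - x)) at_infinity (at x)"
    by (rule tendsto_mult_filterlim_at_infinity[OF tendsto_const assms(2)])
  from tendsto_add_filterlim_at_infinity[OF lim this]
  have inf: "filterlim q at_infinity (at x)" by (simp add: divide_inverse)
  then show "is_real_pole q x"
    unfolding is_real_pole_def using filterlim_at_infinity_imp_norm_at_top by fastforce
  show "\<not> isCont q x"
    using inf not_tendsto_and_filterlim_at_infinity[of "at x" q] by (auto simp: isCont_def)
  show "(\<lambda>s. q s - \<epsilon> / (s - x)) \<in> O[at x](\<lambda>_. 1)"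
    by (rule bigoI_tendsto[where c = L]) (use lim in simp_all)
qed

text \<open>Negation reverses the sorted list, so the middle entry equals its own negative.\<close>

lemma symmetric_sorted_middle:
  fixes S :: "real set"
  assumes "finite S" "\<And>x. x \<in> S \<Longrightarrow> - x \<in> S" "card S = 2 * l + 1"
  shows "sorted_list_of_set S ! l = 0"
proof -
  let ?t = "sorted_list_of_set S"
  have len: "length ?t = 2 * l + 1" using assms(3) by simp
  have "uminus ` S = S"
  proof
    show "uminus ` S \<subseteq> S" using assms(2) by auto
    show "S \<subseteq> uminus ` S" using assms(2) by (metis add.inverse_inverse image_eqI subsetI)
  qed
  moreover have "sorted (map uminus (rev ?t))"
    by (simp add: sorted_wrt_map sorted_wrt_rev)
  ultimately have "map uminus (rev ?t) = ?t"
    by (intro sorted_distinct_set_unique) (use assms(1) in \<open>auto simp: distinct_map inj_on_def\<close>)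
  then have "?t ! l = map uminus (rev ?t) ! l" by simp
  also have "\<dots> = - (?t ! l)" using len by (simp add: rev_nth)
  finally show ?thesis by simp
qed

lemma rhombus_signature:
  assumes rh: "rhombus A N B C a b c (pre @ [s] @ post)" and len: "length pre = length post"
    and a1: "2 * a1 = - (b - c + 2/3)"
  shows "has_signature a1 (\<lambda>t. - (2/3) * t + poly (pderiv B) t / poly B t - poly (pderiv C) t / poly C t) pre s post"
proof -
  define q where "q = (\<lambda>t. - (2/3) * t + poly (pderiv B) t / poly B t - poly (pderiv C) t / poly C t)"
  let ?p = "A * N * B * C" and ?\<kappa> = "b - c + 2/3"
  have tr: "triangle A B C a b c" and ed: "edge A N B C" and k: "b - c + 2/3 > 0"
    and par: "has_parity A" "has_parity N" "has_parity B" "has_parity C"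
    and w: "root_word A N B C = pre @ [s] @ post" using rh by (auto simp: rhombus_def)
  note f = rhombus_facts[OF tr ed k]
  have fin: "finite {x. poly ?p x = 0}" using f(1) by (rule poly_roots_finite)
  define ts where "ts = sorted_list_of_set {x. poly ?p x = 0}"
  have q_eq: "q t = poly (smult (- (sqrt 2 / 3)) (A * N)) t / poly (B * C) t" if "poly (B * C) t \<noteq> 0" for t
  proof -
    have "q t = (poly (pderiv B) t * poly C t - poly B t * poly (pderiv C) t - (2/3) * t * poly B t * poly C t)
        / (poly B t * poly C t)"
      using that by (simp add: q_def field_simps)
    also have "\<dots> = (- (sqrt 2 / 3) * (poly A t * poly N t)) / (poly B t * poly C t)"
      unfolding edge_poly[OF ed] ..
    finally show ?thesis by simp
  qed
  have regular: "isCont q t" if "poly B t \<noteq> 0" "poly C t \<noteq> 0" for t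
    unfolding q_def using that by (intro continuous_intros) auto
  have zeroN: "has_sing_type a1 q Zp x" if "poly N x = 0" for x
  proof -
    note g = f(3)[OF that]
    have d: "poly (B * C) x \<noteq> 0" using g by simp
    \<comment> \<open>At a root of N the numerator c0 A N has derivative c0 A N', which the
      Wronskian relation equates with - (b - c + 2/3) B C, so the slope of q is 2 a1. At a root of A
      the sign is reversed.\<close>
    have "poly (pderiv (smult (- (sqrt 2 / 3)) (A * N))) x = (2 * a1) * poly (B * C) x"
      using wronskian_poly[OF tr ed, of x] that unfolding a1 by (simp add: pderiv_smult pderiv_mult pderiv_minus algebra_simps)
    from simple_zero_expansion[OF q_eq d _ this] that q_eq[OF d] show ?thesis by simp
  qed
  have zeroA: "has_sing_type a1 q Zm x" if "poly A x = 0" for x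
  proof -
    note g = f(2)[OF that]
    have d: "poly (B * C) x \<noteq> 0" using g by simp
    have "poly (pderiv (smult (- (sqrt 2 / 3)) (A * N))) x = - (2 * a1) * poly (B * C) x"
      using wronskian_poly[OF tr ed, of x] that unfolding a1 by (simp add: pderiv_smult pderiv_mult pderiv_minus algebra_simps)
    from simple_zero_expansion[OF q_eq d _ this] that q_eq[OF d] show ?thesis by simp
  qed
  have poleB: "\<exists>L. ((\<lambda>s. q s - 1 / (s - x)) \<longlongrightarrow> L) (at x)" if "poly B x = 0" for x
  proof -
    have "poly (pderiv B) x \<noteq> 0" using tr that by (simp add: triangle_def real_roots_simple_def)
    from log_derivative_expansion[OF that this]
    obtain L where L: "((\<lambda>s. poly (pderiv B) s / poly B s - 1 / (s - x)) \<longlongrightarrow> L) (at x)" .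
    have C: "poly C x \<noteq> 0" using f(4)[OF that] by simp
    have "((\<lambda>s. - (2/3) * s + (poly (pderiv B) s / poly B s - 1 / (s - x)) - poly (pderiv C) s / poly C s)
        \<longlongrightarrow> - (2/3) * x + L - poly (pderiv C) x / poly C x) (at x)"
      using C by (intro tendsto_intros L) auto
    then show ?thesis unfolding q_def by (intro exI) (simp add: algebra_simps)
  qed
  have poleC: "\<exists>L. ((\<lambda>s. q s - (- 1) / (s - x)) \<longlongrightarrow> L) (at x)" if "poly C x = 0" for x
  proof -
    have "poly (pderiv C) x \<noteq> 0" using tr that by (simp add: triangle_def real_roots_simple_def)
    from log_derivative_expansion[OF that this]
    obtain L where L: "((\<lambda>s. poly (pderiv C) s / poly C s - 1 / (s - x)) \<longlongrightarrow> L) (at x)" .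
    have B: "poly B x \<noteq> 0" using f(5)[OF that] by simp
    have "((\<lambda>s. - (2/3) * s + poly (pderiv B) s / poly B s - (poly (pderiv C) s / poly C s - 1 / (s - x)))
        \<longlongrightarrow> - (2/3) * x + poly (pderiv B) x / poly B x - L) (at x)"
      using B by (intro tendsto_intros L) auto
    then show ?thesis unfolding q_def by (intro exI) (simp add: algebra_simps)
  qed
  have pole: "is_real_pole q x \<and> \<not> isCont q x" if "poly B x = 0 \<or> poly C x = 0" for x
    using that poleB[of x] poleC[of x] pole_of_expansion(1,2)[of q _ x] by (metis one_neq_neg_one zero_neq_one zero_neq_neg_one)
  have no_pole: "\<not> is_real_pole q x" if "poly B x \<noteq> 0" "poly C x \<noteq> 0" for x
  proof
    assume "is_real_pole q x"
    then have "filterlim q at_infinity (at x)"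
      unfolding is_real_pole_def by (intro filterlim_norm_at_top_imp_at_infinity) simp
    then show False using regular[OF that] not_tendsto_and_filterlim_at_infinity[of "at x" q]
      by (auto simp: isCont_def)
  qed
  have "is_real_zero q x \<or> is_real_pole q x \<longleftrightarrow> poly ?p x = 0" for x
  proof (cases "poly B x = 0 \<or> poly C x = 0")
    case True
    then show ?thesis using pole[OF True] by auto
  next
    case False
    then show ?thesis using no_pole[of x] regular[of x] q_eq[of x] by (simp add: is_real_zero_def)
  qed
  then have roots: "set ts = {t. is_real_zero q t \<or> is_real_pole q t}"
    using fin by (simp add: ts_def del: poly_mult)
  have labels: "map (root_label A N B) ts = pre @ [s] @ post" using w by (simp add: root_word_def ts_def)
  have len_ts: "length ts = length (pre @ [s] @ post)" using arg_cong[OF labels, of length] by simp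
  have sing_type: "has_sing_type a1 q (root_label A N B x) x" if "poly ?p x = 0" for x
  proof -
    have B: "has_sing_type a1 q Pp x" if "poly B x = 0"
      using poleB[OF that] pole_of_expansion(3)[of q 1 x] by auto
    have C: "has_sing_type a1 q Pm x" if "poly C x = 0"
      using poleC[OF that] pole_of_expansion(3)[of q "-1" x] by auto
    show ?thesis using that zeroN[of x] zeroA[of x] B C by (auto simp: root_label_def)
  qed
  have "has_sing_type a1 q ((pre @ [s] @ post) ! i) (ts ! i)" if "i < length ts" for i
  proof -
    have "ts ! i \<in> set ts" using that by simp
    then have "poly ?p (ts ! i) = 0" using fin by (simp add: ts_def del: poly_mult)
    from sing_type[OF this] show ?thesis unfolding labels[symmetric] using that by simp
  qed
  \<comment> \<open>Parity makes the root set symmetric, and equal lengths of \<open>pre\<close> and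
    \<open>post\<close> put the marked letter in the middle.\<close>
  moreover have "ts ! length pre = 0"
    unfolding ts_def
  proof (rule symmetric_sorted_middle[OF fin])
    have par0: "poly p (- x) = 0" if p: "has_parity p" and "poly p x = 0" for p x
    proof -
      obtain r where "pcompose p [:0, -1:] = smult r p" using p unfolding has_parity_def by blast
      from arg_cong[OF this, of "\<lambda>p. poly p x"] that show ?thesis by (simp add: poly_pcompose)
    qed
    show "- x \<in> {x. poly ?p x = 0}" if "x \<in> {x. poly ?p x = 0}" for x
      using that par0[OF par(1)] par0[OF par(2)] par0[OF par(3)] par0[OF par(4)] by auto
    show "card {x. poly ?p x = 0} = 2 * length pre + 1"
      using len_ts len by (simp add: ts_def)
  qed
  ultimately show ?thesis
    unfolding has_signature_def q_def[symmetric] using roots len_ts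
    by (intro exI[of _ ts]) (simp add: ts_def)
qed

text \<open>The base edge of the rhombus lies in row \<open>j + 1\<close>, hence n = - j -
  1.\<close>

lemma horizontal_rhombus_signature:
  assumes "horizontal_rhombus (okamoto_nat Q) i j (pre @ [s] @ post)" "length pre = length post"
    and "m = - int i" "n = - int j - 1"
  shows "has_signature (1/3 + of_int n) (okamoto_rational Q m n) pre s post"
proof -
  have "m - 1 = - int (i + 1)" "n = - int (j + 1)" using assms(3,4) by simp_all
  then have "okamoto_rational Q m n = (\<lambda>t. - (2/3) * t
      + poly (pderiv (okamoto_nat Q (i + 1) (j + 1))) t / poly (okamoto_nat Q (i + 1) (j + 1)) t
      - poly (pderiv (okamoto_nat Q i (j + 1))) t / poly (okamoto_nat Q i (j + 1)) t)"
    by (simp only: fun_eq_iff okamoto_rational_def okamoto_nat_def assms(3)) simp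
  moreover have "2 * (1/3 + of_int n) = - ((2/3) * (real j - real i) - (- (2/3) * (real i + 2 * real j + 1)) + 2/3)"
    unfolding assms(4) by (simp add: field_simps)
  ultimately show ?thesis
    using rhombus_signature[OF assms(1)[unfolded horizontal_rhombus_def] assms(2)] by presburger
qed

section \<open>The four parity cases\<close>

theorem mainTheorem4:
  fixes Q :: "int \<Rightarrow> int \<Rightarrow> real poly" and m n :: int and \<mu> \<nu> :: nat
  assumes "okamoto_family Q"
    and "m \<le> -1" and "n \<le> -1"
  shows
   "(m = - 2 * int \<mu> \<and> n = - 2 * int \<nu> \<longrightarrow>
      has_signature (1/3 + of_int n) (okamoto_rational Q m n)
        (wpow [Zp, Pp, Pm, Zm] \<nu> @ wpow [Zp, Zm] (\<mu> - 1) @ [Zp])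
        Zm
        ([Zp] @ wpow [Zm, Zp] (\<mu> - 1) @ wpow [Zm, Pm, Pp, Zp] \<nu>)) \<and>
    (m = - 2 * int \<mu> \<and> n = - 2 * int \<nu> - 1 \<longrightarrow>
      has_signature (1/3 + of_int n) (okamoto_rational Q m n)
        (wpow [Zp, Pp, Pm, Zm] \<nu> @ [Zp] @ wpow [Pp, Pm] \<mu>)
        Pp
        (wpow [Pm, Pp] \<mu> @ [Zp] @ wpow [Zm, Pm, Pp, Zp] \<nu>)) \<and>
    (m = - 2 * int \<mu> - 1 \<and> n = - 2 * int \<nu> \<longrightarrow>
      has_signature (1/3 + of_int n) (okamoto_rational Q m n)
        (wpow [Zp, Pp, Pm, Zm] \<nu> @ wpow [Zp, Zm] \<mu>)
        Zp
        (wpow [Zm, Zp] \<mu> @ wpow [Zm, Pm, Pp, Zp] \<nu>)) \<and>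
    (m = - 2 * int \<mu> - 1 \<and> n = - 2 * int \<nu> - 1 \<longrightarrow>
      has_signature (1/3 + of_int n) (okamoto_rational Q m n)
        (wpow [Zp, Pp, Pm, Zm] \<nu> @ [Zp] @ wpow [Pp, Pm] \<mu> @ [Pp])
        Pm
        ([Pp] @ wpow [Pm, Pp] \<mu> @ [Zp] @ wpow [Zm, Pm, Pp, Zp] \<nu>))"
proof (intro conjI impI; elim conjE)
  note odd = horizontal_rhombus_words(1)[OF assms(1)] and even = horizontal_rhombus_words(2)[OF assms(1)]
  have frame: "wpow [Zp, Pp, Pm, Zm] (Suc k) @ u @ wpow [Zm, Pm, Pp, Zp] (Suc k)
      = framed k ([Zp, Pp, Pm, Zm] @ u @ [Zm, Pm, Pp, Zp])" for k u
    using framed_Suc[of k u] by (simp add: framed_def)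
  {
    assume mn: "m = - 2 * int \<mu>" "n = - 2 * int \<nu>"
    \<comment> \<open>Row n = -2 \<nu> means j = 2 \<nu>' + 1, and \<open>wordH2\<close> itself
      holds one of the \<nu> outer blocks on each side. From m <= -1 comes \<mu> >= 1, so
      \<open>\<mu> - 1\<close> is not truncated.\<close>
    with assms(2,3) obtain \<mu>' \<nu>' where s: "\<mu> = Suc \<mu>'" "\<nu> = Suc \<nu>'" by (cases \<mu>; cases \<nu>) auto
    \<comment> \<open>The last \<open>Zm\<close> of the power completes the right outer block;
      shifting the period mirrors the right half.\<close>
    have "wordH2 (2 * \<mu>) = [Zp, Pp, Pm, Zm] @ (wpow [Zp, Zm] \<mu>' @ [Zp, Zm, Zp] @ wpow [Zm, Zp] \<mu>') @ [Zm, Pm, Pp, Zp]"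
      by (simp add: s wordH2_def mult_2 wpow_add wpow_Suc wpow_rotate)
    with frame[of \<nu>' "wpow [Zp, Zm] \<mu>' @ [Zp, Zm, Zp] @ wpow [Zm, Zp] \<mu>'"] even[of "2 * \<mu>" \<nu>']
    show "has_signature (1/3 + of_int n) (okamoto_rational Q m n)
        (wpow [Zp, Pp, Pm, Zm] \<nu> @ wpow [Zp, Zm] (\<mu> - 1) @ [Zp]) Zm
        ([Zp] @ wpow [Zm, Zp] (\<mu> - 1) @ wpow [Zm, Pm, Pp, Zp] \<nu>)"
      by (intro horizontal_rhombus_signature[where i = "2 * \<mu>" and j = "2 * \<nu>' + 1"]) (simp_all add: mn s length_wpow)
  next
    assume mn: "m = - 2 * int \<mu>" "n = - 2 * int \<nu> - 1"
    have "wordH1 (2 * \<mu>) = [Zp] @ wpow [Pp, Pm] \<mu> @ [Pp] @ wpow [Pm, Pp] \<mu> @ [Zp]"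
      by (simp add: wordH1_def mult_2 wpow_add wpow_rotate)
    with odd[of "2 * \<mu>" \<nu>]
    show "has_signature (1/3 + of_int n) (okamoto_rational Q m n)
        (wpow [Zp, Pp, Pm, Zm] \<nu> @ [Zp] @ wpow [Pp, Pm] \<mu>) Pp
        (wpow [Pm, Pp] \<mu> @ [Zp] @ wpow [Zm, Pm, Pp, Zp] \<nu>)"
      by (intro horizontal_rhombus_signature[where i = "2 * \<mu>" and j = "2 * \<nu>"]) (simp_all add: mn framed_def length_wpow)
  next
    assume mn: "m = - 2 * int \<mu> - 1" "n = - 2 * int \<nu>"
    with assms(3) obtain \<nu>' where s: "\<nu> = Suc \<nu>'" by (cases \<nu>) auto
    have "wordH2 (2 * \<mu> + 1) = [Zp, Pp, Pm, Zm] @ (wpow [Zp, Zm] \<mu> @ [Zp] @ wpow [Zm, Zp] \<mu>) @ [Zm, Pm, Pp, Zp]"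
      by (simp add: wordH2_def mult_2 wpow_add wpow_Suc_right wpow_rotate)
    with frame[of \<nu>' "wpow [Zp, Zm] \<mu> @ [Zp] @ wpow [Zm, Zp] \<mu>"] even[of "2 * \<mu> + 1" \<nu>']
    show "has_signature (1/3 + of_int n) (okamoto_rational Q m n)
        (wpow [Zp, Pp, Pm, Zm] \<nu> @ wpow [Zp, Zm] \<mu>) Zp
        (wpow [Zm, Zp] \<mu> @ wpow [Zm, Pm, Pp, Zp] \<nu>)"
      by (intro horizontal_rhombus_signature[where i = "2 * \<mu> + 1" and j = "2 * \<nu>' + 1"]) (simp_all add: mn s length_wpow)
  next
    assume mn: "m = - 2 * int \<mu> - 1" "n = - 2 * int \<nu> - 1"
    \<comment> \<open>The odd exponent places a \<open>Pm\<close> at the centre, between two copies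
      of \<open>Pp\<close>.\<close>
    have "wordH1 (2 * \<mu> + 1) = [Zp] @ wpow [Pp, Pm] \<mu> @ [Pp, Pm, Pp] @ wpow [Pm, Pp] \<mu> @ [Zp]"
      using wpow_add[of "[Pp, Pm]" \<mu> "Suc \<mu>"] by (simp add: wordH1_def mult_2 wpow_Suc[of _ \<mu>] wpow_rotate)
    with odd[of "2 * \<mu> + 1" \<nu>]
    show "has_signature (1/3 + of_int n) (okamoto_rational Q m n)
        (wpow [Zp, Pp, Pm, Zm] \<nu> @ [Zp] @ wpow [Pp, Pm] \<mu> @ [Pp]) Pm
        ([Pp] @ wpow [Pm, Pp] \<mu> @ [Zp] @ wpow [Zm, Pm, Pp, Zp] \<nu>)"
      by (intro horizontal_rhombus_signature[where i = "2 * \<mu> + 1" and j = "2 * \<nu>"]) (simp_all add: mn framed_def length_wpow)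
  }
qed

end
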